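(* Let $d\geq 2$ and let $\mathfrak{g}$ be a Lifshitz Lie algebra of dimension $d(d+1)/2+2$ (as defined in the context). Then $\mathfrak{g}$ is isomorphic to precisely one Lie algebra in the following list. Each algebra in the list has basis $J_{ab}=-J_{ba}$, $P_a$, $H$, $D$ ($a,b=1,\dots,d$), with the common brackets \[ [J_{ab},J_{cd}] = \delta_{bc} J_{ad} - \delta_{ac} J_{bd} - \delta_{bd} J_{ac} + \delta_{ad} J_{bc},\qquad [J_{ab},P_c]=\delta_{bc}P_a-\delta_{ac}P_b,\qquad [J_{ab},H]=[J_{ab},D]=0, \] and in addition only the following nonzero brackets (all brackets not listed and not determined by antisymmetry vanish): \begin{itemize} \item $\mathfrak{a}_1$ ($d\geq 2$): no further nonzero brackets; \item $\mathfrak{a}_2$ ($d\geq 2$): $[D,H]=H$; \item $\mathfrak{a}_3^z$ ($d\geq 2$), for a parameter $z\in\mathbb{R}$: $[D,H]=zH$, $[D,P_a]=P_a$; \item $\mathfrak{a}_4^\pm$ ($d\geq 2$): $[P_a,P_b]=\pm J_{ab}$; \item $\mathfrak{a}_5^\pm$ ($d\geq 2$): $[D,H]=H$, $[P_a,P_b]=\pm J_{ab}$; \item $\mathfrak{a}_6$ (only $d=2$): $[P_a,P_b]=\epsilon_{ab}H$; \item $\mathfrak{a}_7$ (only $d=2$): $[D,H]=2H$, $[D,P_a]=P_a$, $[P_a,P_b]=\epsilon_{ab}H$. \end{itemize}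
   Context: A Lifshitz Lie algebra is a real Lie algebra $\mathfrak{g}$ of dimension $d(d+1)/2+2$ with a basis $J_{ab}=-J_{ba}$, $P_a$, $H$, $D$ ($a,b=1,\dots,d$) such that the $J_{ab}$ span a Lie subalgebra isomorphic to $\mathfrak{so}(d)$ with brackets $[J_{ab},J_{cd}] = \delta_{bc} J_{ad} - \delta_{ac} J_{bd} - \delta_{bd} J_{ac} + \delta_{ad} J_{bc}$, under which the $P_a$ transform as a vector, $[J_{ab},P_c]=\delta_{bc}P_a-\delta_{ac}P_b$, and $H$ and $D$ transform as scalars, $[J_{ab},H]=[J_{ab},D]=0$; the remaining brackets are arbitrary subject only to the Jacobi identity. $\epsilon_{ab}$ denotes the Levi-Civita symbol in two dimensions. *)

theory Defs
  imports "HOL-Analysis.Analysis"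
begin

text \<open>Index set of the standard basis J_ab (a<b), P_a, H, D of a Lifshitz algebra.\<close>
datatype lidx = LJ nat nat | LP nat | LH | LD

definition Idx :: "nat \<Rightarrow> lidx set" where
  "Idx d = {LJ a b | a b. 1 \<le> a \<and> a < b \<and> b \<le> d} \<union> {LP a | a. 1 \<le> a \<and> a \<le> d} \<union> {LH, LD}"

definition lie_algebra :: "('v::real_vector \<Rightarrow> 'v \<Rightarrow> 'v) \<Rightarrow> bool" where
  "lie_algebra br \<longleftrightarrow> bilinear br \<and> (\<forall>x. br x x = 0) \<and>
     (\<forall>x y z. br x (br y z) + br y (br z x) + br z (br x y) = 0)"

definition lie_iso :: "('v::real_vector \<Rightarrow> 'v \<Rightarrow> 'v) \<Rightarrow> ('w::real_vector \<Rightarrow> 'w \<Rightarrow> 'w) \<Rightarrow> ('v \<Rightarrow> 'w) \<Rightarrow> bool" where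
  "lie_iso br1 br2 f \<longleftrightarrow> linear f \<and> bij f \<and> (\<forall>x y. f (br1 x y) = br2 (f x) (f y))"

definition is_basis :: "nat \<Rightarrow> (lidx \<Rightarrow> 'v::real_vector) \<Rightarrow> bool" where
  "is_basis d B \<longleftrightarrow> inj_on B (Idx d) \<and> independent (B ` Idx d) \<and> span (B ` Idx d) = UNIV"

definition kd :: "nat \<Rightarrow> nat \<Rightarrow> real" where
  "kd i j = (if i = j then 1 else 0)"

definition Jv :: "(lidx \<Rightarrow> 'v::real_vector) \<Rightarrow> nat \<Rightarrow> nat \<Rightarrow> 'v" where
  "Jv B a b = (if a < b then B (LJ a b) else if b < a then - B (LJ b a) else 0)"

abbreviation Pv :: "(lidx \<Rightarrow> 'v::real_vector) \<Rightarrow> nat \<Rightarrow> 'v" where "Pv B a \<equiv> B (LP a)"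
abbreviation Hv :: "(lidx \<Rightarrow> 'v::real_vector) \<Rightarrow> 'v" where "Hv B \<equiv> B LH"
abbreviation Dv :: "(lidx \<Rightarrow> 'v::real_vector) \<Rightarrow> 'v" where "Dv B \<equiv> B LD"

definition eps2 :: "nat \<Rightarrow> nat \<Rightarrow> real" where
  "eps2 a b = (if a = 1 \<and> b = 2 then 1 else if a = 2 \<and> b = 1 then -1 else 0)"

definition common_brackets :: "nat \<Rightarrow> ('v::real_vector \<Rightarrow> 'v \<Rightarrow> 'v) \<Rightarrow> (lidx \<Rightarrow> 'v) \<Rightarrow> bool" where
  "common_brackets d br B \<longleftrightarrow>
    (\<forall>a\<in>{1..d}. \<forall>b\<in>{1..d}. \<forall>c\<in>{1..d}. \<forall>e\<in>{1..d}.
       br (Jv B a b) (Jv B c e) = kd b c *\<^sub>R Jv B a e - kd a c *\<^sub>R Jv B b e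
                                 - kd b e *\<^sub>R Jv B a c + kd a e *\<^sub>R Jv B b c) \<and>
    (\<forall>a\<in>{1..d}. \<forall>b\<in>{1..d}. \<forall>c\<in>{1..d}.
       br (Jv B a b) (Pv B c) = kd b c *\<^sub>R Pv B a - kd a c *\<^sub>R Pv B b) \<and>
    (\<forall>a\<in>{1..d}. \<forall>b\<in>{1..d}. br (Jv B a b) (Hv B) = 0 \<and> br (Jv B a b) (Dv B) = 0)"

definition lifshitz :: "nat \<Rightarrow> ('v::real_vector \<Rightarrow> 'v \<Rightarrow> 'v) \<Rightarrow> (lidx \<Rightarrow> 'v) \<Rightarrow> bool" where
  "lifshitz d br B \<longleftrightarrow> lie_algebra br \<and> is_basis d B \<and> common_brackets d br B"

datatype lab = A1 | A2 | A3 real | A4 bool | A5 bool | A6 | A7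

fun valid_lab :: "nat \<Rightarrow> lab \<Rightarrow> bool" where
  "valid_lab d A6 = (d = 2)"
| "valid_lab d A7 = (d = 2)"
| "valid_lab d _ = (2 \<le> d)"

fun sgn_of :: "bool \<Rightarrow> real" where
  "sgn_of True = 1" | "sgn_of False = -1"

fun pp :: "lab \<Rightarrow> (lidx \<Rightarrow> 'v::real_vector) \<Rightarrow> nat \<Rightarrow> nat \<Rightarrow> 'v" where
  "pp (A4 s) B a b = sgn_of s *\<^sub>R Jv B a b"
| "pp (A5 s) B a b = sgn_of s *\<^sub>R Jv B a b"
| "pp A6 B a b = eps2 a b *\<^sub>R Hv B"
| "pp A7 B a b = eps2 a b *\<^sub>R Hv B"
| "pp _ B a b = 0"

fun dh :: "lab \<Rightarrow> real" where
  "dh A2 = 1" | "dh (A3 z) = z" | "dh (A5 s) = 1" | "dh A7 = 2" | "dh _ = 0"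

fun dp :: "lab \<Rightarrow> real" where
  "dp (A3 z) = 1" | "dp A7 = 1" | "dp _ = 0"

definition realises :: "nat \<Rightarrow> lab \<Rightarrow> ('v::real_vector \<Rightarrow> 'v \<Rightarrow> 'v) \<Rightarrow> (lidx \<Rightarrow> 'v) \<Rightarrow> bool" where
  "realises d L br B \<longleftrightarrow> lie_algebra br \<and> is_basis d B \<and> common_brackets d br B \<and>
    (\<forall>a\<in>{1..d}. \<forall>b\<in>{1..d}. br (Pv B a) (Pv B b) = pp L B a b) \<and>
    (\<forall>a\<in>{1..d}. br (Pv B a) (Hv B) = 0 \<and> br (Dv B) (Pv B a) = dp L *\<^sub>R Pv B a) \<and>
    br (Dv B) (Hv B) = dh L *\<^sub>R Hv B"

end

theory Submission
  imports Defs
begin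

text \<open>
  An isomorphism transports bases, so \<open>\<gg>\<close> is isomorphic to a listed algebra iff \<open>\<gg>\<close> itself has a
  basis with the listed brackets.

  Existence: Jacobi with \<open>J\<^sub>a\<^sub>b\<close> makes all remaining brackets rotation equivariant. This leaves few free
  coefficients; the exotic ones (\<open>\<epsilon>\<^sub>a\<^sub>b\<close> for \<open>d = 2\<close>, \<open>\<epsilon>\<^sub>a\<^sub>b\<^sub>c\<close> for \<open>d = 3\<close>, \<open>\<epsilon>\<^sub>a\<^sub>b\<^sub>c\<^sub>d\<close> for \<open>d = 4\<close>) are
  killed by shifting \<open>H\<close>, \<open>D\<close> by \<open>J\<^sub>1\<^sub>2\<close>, by shifting \<open>P\<^sub>a\<close> by the dual of \<open>J\<close>, and by the Jacobi identity
  on \<open>P\<close>, respectively. The rest is a linear change of \<open>H\<close>, \<open>D\<close> and a rescaling of \<open>P\<close>.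

  Uniqueness: call \<open>v\<close> \<^emph>\<open>ideal\<close> if its span is an ideal. A nonzero ideal vector of the form
  \<open>[[x,y],[x',y']]\<close> exists only in \<open>\<aa>\<^sub>6\<close>, \<open>\<aa>\<^sub>7\<close>. A non-ideal \<open>v\<close> with \<open>(ad v)\<^sup>2 = 0\<close> exists in
  \<open>\<aa>\<^sub>1\<close>, \<open>\<aa>\<^sub>2\<close>, \<open>\<aa>\<^sub>3\<close> but not in \<open>\<aa>\<^sub>4\<close>, \<open>\<aa>\<^sub>5\<close>. Among \<open>\<aa>\<^sub>1\<close> to \<open>\<aa>\<^sub>5\<close>, an \<open>x\<close> with \<open>[x,y] = y\<close> for some
  non-ideal \<open>y\<close> exists only in \<open>\<aa>\<^sub>3\<close> and for the positive sign in \<open>\<aa>\<^sub>4\<close>, \<open>\<aa>\<^sub>5\<close>. Triviality of the centre separates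
  the remaining pairs. In \<open>\<aa>\<^sub>3\<^sup>z\<close> every such \<open>x\<close> acts on the ideal line by \<open>z\<close>, which recovers \<open>z\<close>.
\<close>

section \<open>Coordinates of a Lifshitz algebra\<close>

lemma finite_Idx: "finite (Idx d)"
proof -
  have "Idx d \<subseteq> (\<lambda>(a, b). LJ a b) ` ({..d} \<times> {..d}) \<union> LP ` {..d} \<union> {LH, LD}"
    unfolding Idx_def by auto
  then show ?thesis
    by (rule finite_subset) auto
qed

lemma kd_commute: "kd i j = kd j i"
  by (simp add: kd_def)

lemma kd_simps [simp]: "kd i i = 1" "i \<noteq> j \<Longrightarrow> kd i j = 0"
  by (simp_all add: kd_def)

lemma sum_kd [simp]:
  assumes "finite S" "a \<in> S"
  shows "(\<Sum>k\<in>S. kd k a * f k) = f a" "(\<Sum>k\<in>S. kd a k * f k) = f a"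
    "(\<Sum>k\<in>S. f k * kd k a) = f a" "(\<Sum>k\<in>S. f k * kd a k) = f a"
  using assms by (simp_all add: kd_def if_distrib[of "\<lambda>t. t * _"] if_distrib[of "\<lambda>t. _ * t"] cong: if_cong)

lemma Jv_commute: "Jv B a b = - Jv B b a"
  by (simp add: Jv_def)

lemma Jv_refl [simp]: "Jv B a a = 0"
  by (simp add: Jv_def)

text \<open>The new family spans and is indexed by a finite set as large as the old basis, so
  dimension counting forces injectivity and independence. Later changes of basis only have to
  recover the old vectors from the new ones.\<close>

lemma is_basis_if_spans:
  fixes B B' :: "lidx \<Rightarrow> 'v::real_vector"
  assumes B: "is_basis d B" and sp: "\<And>i. i \<in> Idx d \<Longrightarrow> B i \<in> span (B' ` Idx d)"
  shows "is_basis d B'"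
proof -
  let ?S = "B' ` Idx d"
  have indB: "independent (B ` Idx d)" and cardB: "card (B ` Idx d) = card (Idx d)"
    using B by (auto simp: is_basis_def card_image)
  have "span (B ` Idx d) \<subseteq> span ?S"
    using sp by (intro span_minimal) auto
  then have sU: "span ?S = UNIV"
    using B by (auto simp: is_basis_def)
  have bound: "card (Idx d) \<le> card T" if "finite T" "span T = UNIV" for T :: "'v set"
    using independent_span_bound[OF that(1) indB] that(2) cardB by simp
  have "card (Idx d) \<le> card ?S"
    using bound finite_Idx sU by blast
  then have inj: "inj_on B' (Idx d)"
    by (intro eq_card_imp_inj_on finite_Idx antisym card_image_le)
  have "independent ?S"
  proof
    assume "dependent ?S"
    then obtain a where a: "a \<in> ?S" "a \<in> span (?S - {a})"
      by (auto simp: dependent_def)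
    then have "?S \<subseteq> span (?S - {a})"
      by (metis Diff_iff insertE insert_Diff span_base subsetI)
    then have "span ?S \<subseteq> span (?S - {a})"
      by (intro span_minimal) auto
    then have "card (Idx d) \<le> card (?S - {a})"
      using sU finite_Idx by (intro bound) auto
    also have "\<dots> < card ?S"
      using a finite_Idx by (intro psubset_card_mono) auto
    also have "\<dots> \<le> card (Idx d)"
      by (intro card_image_le finite_Idx)
    finally show False by simp
  qed
  then show ?thesis
    using inj sU by (simp add: is_basis_def)
qed

locale indexed_basis =
  fixes d :: nat and B :: "lidx \<Rightarrow> 'v::real_vector"
  assumes d_ge_2: "2 \<le> d" and basis: "is_basis d B"
begin

lemma one_two_mem: "1 \<in> {1..d}" "2 \<in> {1..d}"
  using d_ge_2 by auto

definition coord :: "lidx \<Rightarrow> 'v \<Rightarrow> real" where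
  "coord i x = representation (B ` Idx d) x (B i)"

text \<open>Extended antisymmetrically, in parallel with \<open>Jv\<close>: the
  \<open>J\<close>-part of a vector becomes an antisymmetric matrix, and sums may run over all index
  pairs.\<close>

definition cJ :: "nat \<Rightarrow> nat \<Rightarrow> 'v \<Rightarrow> real" where
  "cJ m n x = (if m < n then coord (LJ m n) x else if n < m then - coord (LJ n m) x else 0)"

definition "cP n = coord (LP n)"
definition "cH = coord LH"
definition "cD = coord LD"

lemma linear_coord: "linear (coord i)"
proof -
  have *: "independent (B ` Idx d)" "\<And>x. x \<in> span (B ` Idx d)"
    using basis by (auto simp: is_basis_def)
  show ?thesis
    unfolding coord_def
    by (intro linearI) (simp_all add: representation_add[OF *(1) *(2) *(2)] representation_scale[OF *(1) *(2)])
qed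

lemma linear_cJ: "linear (cJ m n)"
proof -
  have "linear (\<lambda>x. - coord (LJ n m) x)"
    by (intro linear_compose_neg linear_coord)
  then show ?thesis
    unfolding cJ_def using linear_coord linear_zero
    by (cases m n rule: linorder_cases) simp_all
qed

lemma linear_cP: "linear (cP n)" and linear_cH: "linear cH" and linear_cD: "linear cD"
  unfolding cP_def cH_def cD_def by (rule linear_coord)+

lemmas coord_linear = linear_cJ linear_cP linear_cH linear_cD

lemmas coord_simps [simp] =
  coord_linear[THEN linear_add] coord_linear[THEN linear_diff]
  coord_linear[THEN linear_scale] coord_linear[THEN linear_neg]
  coord_linear[THEN linear_0]

lemma coord_basis: "i \<in> Idx d \<Longrightarrow> j \<in> Idx d \<Longrightarrow> coord i (B j) = (if i = j then 1 else 0)"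
  using basis representation_basis[of "B ` Idx d" "B j"]
  by (auto simp: is_basis_def coord_def inj_on_def)

lemma Idx_mem:
  "1 \<le> a \<Longrightarrow> a < b \<Longrightarrow> b \<le> d \<Longrightarrow> LJ a b \<in> Idx d"
  "a \<in> {1..d} \<Longrightarrow> LP a \<in> Idx d" "LH \<in> Idx d" "LD \<in> Idx d"
  by (auto simp: Idx_def)

lemma cJ_commute: "cJ m n x = - cJ n m x"
  by (simp add: cJ_def)

lemma cJ_refl [simp]: "cJ m m x = 0"
  by (simp add: cJ_def)

lemma cJ_basis [simp]:
  assumes "m \<in> {1..d}" "n \<in> {1..d}"
  shows "a \<in> {1..d} \<Longrightarrow> b \<in> {1..d} \<Longrightarrow> cJ m n (Jv B a b) = kd m a * kd n b - kd m b * kd n a"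
    "a \<in> {1..d} \<Longrightarrow> cJ m n (Pv B a) = 0" "cJ m n (Hv B) = 0" "cJ m n (Dv B) = 0"
  using assms
  by (auto simp: cJ_def Jv_def kd_def coord_basis Idx_mem linear_neg[OF linear_coord] linear_0[OF linear_coord])

lemma cP_basis [simp]:
  assumes "n \<in> {1..d}"
  shows "a \<in> {1..d} \<Longrightarrow> b \<in> {1..d} \<Longrightarrow> cP n (Jv B a b) = 0"
    "a \<in> {1..d} \<Longrightarrow> cP n (Pv B a) = kd n a" "cP n (Hv B) = 0" "cP n (Dv B) = 0"
  using assms
  by (auto simp: cP_def Jv_def kd_def coord_basis Idx_mem linear_neg[OF linear_coord] linear_0[OF linear_coord])

lemma cH_basis [simp]:
  "a \<in> {1..d} \<Longrightarrow> b \<in> {1..d} \<Longrightarrow> cH (Jv B a b) = 0"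
  "a \<in> {1..d} \<Longrightarrow> cH (Pv B a) = 0" "cH (Hv B) = 1" "cH (Dv B) = 0"
  by (auto simp: cH_def Jv_def kd_def coord_basis Idx_mem linear_neg[OF linear_coord] linear_0[OF linear_coord])

lemma cD_basis [simp]:
  "a \<in> {1..d} \<Longrightarrow> b \<in> {1..d} \<Longrightarrow> cD (Jv B a b) = 0"
  "a \<in> {1..d} \<Longrightarrow> cD (Pv B a) = 0" "cD (Hv B) = 0" "cD (Dv B) = 1"
  by (auto simp: cD_def Jv_def kd_def coord_basis Idx_mem linear_neg[OF linear_coord] linear_0[OF linear_coord])

text \<open>Coordinates of a bracket are linear in each argument, so this reduces every coordinate
  formula below to a check on basis vectors.\<close>

lemma linear_ext_basis:
  assumes "linear f" "linear g"
    and J: "\<And>a b. a \<in> {1..d} \<Longrightarrow> b \<in> {1..d} \<Longrightarrow> f (Jv B a b) = g (Jv B a b)"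
    and "\<And>a. a \<in> {1..d} \<Longrightarrow> f (Pv B a) = g (Pv B a)"
    and "f (Hv B) = g (Hv B)" "f (Dv B) = g (Dv B)"
  shows "f x = g x"
proof (rule linear_eq_on_span[OF assms(1,2)])
  show "x \<in> span (B ` Idx d)"
    using basis by (simp add: is_basis_def)
  show "f y = g y" if "y \<in> B ` Idx d" for y
  proof -
    have "f (B (LJ a b)) = g (B (LJ a b))" if "1 \<le> a" "a < b" "b \<le> d" for a b
      using J[of a b] that by (simp add: Jv_def)
    then show ?thesis
      using that assms(4-6) by (auto simp: Idx_def)
  qed
qed

lemma coord_eqI:
  assumes "\<And>m n. m \<in> {1..d} \<Longrightarrow> n \<in> {1..d} \<Longrightarrow> cJ m n x = cJ m n y"
    and "\<And>n. n \<in> {1..d} \<Longrightarrow> cP n x = cP n y" and "cH x = cH y" "cD x = cD y"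
  shows "x = y"
proof -
  have "coord i x = coord i y" if "i \<in> Idx d" for i
  proof -
    have "coord (LJ m n) x = coord (LJ m n) y" if "1 \<le> m" "m < n" "n \<le> d" for m n
      using assms(1)[of m n] that by (simp add: cJ_def)
    then show ?thesis
      using that assms(2-4) by (auto simp: Idx_def cP_def cH_def cD_def)
  qed
  \<comment> \<open>A representation is zero outside the basis, so agreement at the indexed basis
    vectors is enough.\<close>
  then have "representation (B ` Idx d) x b = representation (B ` Idx d) y b" for b
    by (metis coord_def image_iff representation_ne_zero)
  moreover have "independent (B ` Idx d)" "\<And>x. x \<in> span (B ` Idx d)"
    using basis by (auto simp: is_basis_def)
  ultimately show ?thesis
    by (metis (no_types, lifting) ext sum_nonzero_representation_eq)
qed

end

section \<open>Elementary bracket calculus\<close>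

locale lie_bracket =
  fixes br :: "'v::real_vector \<Rightarrow> 'v \<Rightarrow> 'v"
  assumes lie: "lie_algebra br"
begin

lemma linear_br_right: "linear (br x)" and linear_br_left: "linear (\<lambda>x. br x y)"
  using lie by (auto simp: lie_algebra_def bilinear_def)

lemmas br_simps [simp] =
  linear_br_right[THEN linear_add] linear_br_left[THEN linear_add]
  linear_br_right[THEN linear_diff] linear_br_left[THEN linear_diff]
  linear_br_right[THEN linear_scale] linear_br_left[THEN linear_scale]
  linear_br_right[THEN linear_neg] linear_br_left[THEN linear_neg]
  linear_br_right[THEN linear_0] linear_br_left[THEN linear_0]

lemma br_self [simp]: "br x x = 0"
  using lie by (auto simp: lie_algebra_def)

lemma br_commute: "br x y = - br y x"
proof -
  have "br (x + y) (x + y) = 0" by (rule br_self)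
  then have "br x y + br y x = 0"
    by (simp del: br_self add: br_self[of x] br_self[of y] add.commute)
  then show ?thesis by (simp add: eq_neg_iff_add_eq_0)
qed

lemma jacobi: "br x (br y z) + br y (br z x) + br z (br x y) = 0"
  using lie by (auto simp: lie_algebra_def)

lemma br_derivation: "br x (br y z) = br (br x y) z + br y (br x z)"
proof -
  have "br y (br z x) = - br y (br x z)" "br z (br x y) = - br (br x y) z"
    using br_commute[of z x] br_commute[of z "br x y"] by simp_all
  then show ?thesis
    using jacobi[of x y z] by (simp add: algebra_simps)
qed

end

locale lifshitz_algebra = indexed_basis d B + lie_bracket br
  for d and B :: "lidx \<Rightarrow> 'v::real_vector" and br +
  assumes common: "common_brackets d br B"
begin

lemma br_JJ: "\<lbrakk>a \<in> {1..d}; b \<in> {1..d}; c \<in> {1..d}; e \<in> {1..d}\<rbrakk> \<Longrightarrow>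
    br (Jv B a b) (Jv B c e) = kd b c *\<^sub>R Jv B a e - kd a c *\<^sub>R Jv B b e
      - kd b e *\<^sub>R Jv B a c + kd a e *\<^sub>R Jv B b c"
  and br_JP: "\<lbrakk>a \<in> {1..d}; b \<in> {1..d}; c \<in> {1..d}\<rbrakk> \<Longrightarrow>
    br (Jv B a b) (Pv B c) = kd b c *\<^sub>R Pv B a - kd a c *\<^sub>R Pv B b"
  and br_JH: "\<lbrakk>a \<in> {1..d}; b \<in> {1..d}\<rbrakk> \<Longrightarrow> br (Jv B a b) (Hv B) = 0"
  and br_JD: "\<lbrakk>a \<in> {1..d}; b \<in> {1..d}\<rbrakk> \<Longrightarrow> br (Jv B a b) (Dv B) = 0"
  using common unfolding common_brackets_def by blast+

lemmas br_J = br_JJ br_JP br_JH br_JD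

text \<open>Only the common brackets enter, so this holds before anything is known about the others.
  Rotations act on the \<open>J\<close>-part as on an antisymmetric tensor, on the
  \<open>P\<close>-part as on a vector, and never produce \<open>H\<close> or
  \<open>D\<close>.\<close>

lemma coord_br_J:
  assumes "a \<in> {1..d}" "b \<in> {1..d}"
  shows cJ_br_J: "m \<in> {1..d} \<Longrightarrow> n \<in> {1..d} \<Longrightarrow> cJ m n (br (Jv B a b) x) =
      kd a m * cJ b n x - kd b m * cJ a n x - kd b n * cJ m a x + kd a n * cJ m b x"
    and cP_br_J: "n \<in> {1..d} \<Longrightarrow> cP n (br (Jv B a b) x) = kd a n * cP b x - kd b n * cP a x"
    and cH_br_J: "cH (br (Jv B a b) x) = 0"
    and cD_br_J: "cD (br (Jv B a b) x) = 0"
proof -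
  show "cJ m n (br (Jv B a b) x) =
      kd a m * cJ b n x - kd b m * cJ a n x - kd b n * cJ m a x + kd a n * cJ m b x"
    if "m \<in> {1..d}" "n \<in> {1..d}"
  proof (rule linear_ext_basis, goal_cases)
    case (3 a' b')
    then show ?case using that assms
      by (simp add: br_J del: atLeastAtMost_iff) (simp add: kd_commute algebra_simps)
  qed (use that assms in \<open>auto intro!: linearI simp: algebra_simps br_J simp del: atLeastAtMost_iff\<close>)
  show "cP n (br (Jv B a b) x) = kd a n * cP b x - kd b n * cP a x" if "n \<in> {1..d}"
    by (rule linear_ext_basis) 
      (use that assms in \<open>auto intro!: linearI simp: algebra_simps br_J kd_commute simp del: atLeastAtMost_iff\<close>)
  show "cH (br (Jv B a b) x) = 0"
    by (rule linear_ext_basis) 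
      (use assms in \<open>auto intro!: linearI simp: algebra_simps br_J simp del: atLeastAtMost_iff\<close>)
  show "cD (br (Jv B a b) x) = 0"
    by (rule linear_ext_basis) 
      (use assms in \<open>auto intro!: linearI simp: algebra_simps br_J simp del: atLeastAtMost_iff\<close>)
qed

end

section \<open>Brackets in coordinates\<close>

text \<open>The four coefficients \<open>pJ\<close>, \<open>pH\<close>, \<open>dp\<close>,
  \<open>dh\<close> describe all labels uniformly, so the invariants can be computed without going
  through the list.\<close>

fun pJ :: "lab \<Rightarrow> real" where
  "pJ (A4 s) = sgn_of s" | "pJ (A5 s) = sgn_of s" | "pJ _ = 0"

fun pH :: "lab \<Rightarrow> real" where
  "pH A6 = 1" | "pH A7 = 1" | "pH _ = 0"

lemma pp_eq: "pp L B a b = pJ L *\<^sub>R Jv B a b + (pH L * eps2 a b) *\<^sub>R Hv B"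
  by (cases L) auto

text \<open>Exchanging the two summation indices reverses the sign.\<close>

lemma sum_antisym_sym:
  fixes f g :: "'i \<Rightarrow> 'i \<Rightarrow> real"
  assumes "\<And>i j. f i j = - f j i" "\<And>i j. g i j = g j i"
  shows "(\<Sum>i\<in>S. \<Sum>j\<in>S. f i j * g i j) = 0"
proof -
  have "(\<Sum>i\<in>S. \<Sum>j\<in>S. f i j * g i j) = (\<Sum>i\<in>S. \<Sum>j\<in>S. f j i * g j i)"
    by (rule sum.swap)
  also have "\<dots> = (\<Sum>i\<in>S. \<Sum>j\<in>S. - (f i j * g i j))"
    by (intro sum.cong refl) (metis assms mult_minus_left)
  also have "\<dots> = - (\<Sum>i\<in>S. \<Sum>j\<in>S. f i j * g i j)"
    by (simp add: sum_negf)
  finally show ?thesis by simp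
qed

text \<open>The zero vector satisfies this, so a non-ideal vector is automatically nonzero.\<close>

definition ideal1 :: "('v::real_vector \<Rightarrow> 'v \<Rightarrow> 'v) \<Rightarrow> 'v \<Rightarrow> bool" where
  "ideal1 br v \<longleftrightarrow> (\<forall>x. \<exists>c. br x v = c *\<^sub>R v)"

locale realisation =
  fixes d and L and B :: "lidx \<Rightarrow> 'v::real_vector" and br
  assumes d2: "2 \<le> d" and realises_L: "realises d L br B"
begin

sublocale lifshitz_algebra d B br
  using d2 realises_L by unfold_locales (auto simp: realises_def)

lemma br_PP: "a \<in> {1..d} \<Longrightarrow> b \<in> {1..d} \<Longrightarrow>
    br (Pv B a) (Pv B b) = pJ L *\<^sub>R Jv B a b + (pH L * eps2 a b) *\<^sub>R Hv B"
  and br_PH: "a \<in> {1..d} \<Longrightarrow> br (Pv B a) (Hv B) = 0"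
  and br_DP: "a \<in> {1..d} \<Longrightarrow> br (Dv B) (Pv B a) = dp L *\<^sub>R Pv B a"
  and br_DH: "br (Dv B) (Hv B) = dh L *\<^sub>R Hv B"
  using realises_L unfolding realises_def pp_eq[symmetric] by auto

lemma br_rev:
  "a \<in> {1..d} \<Longrightarrow> b \<in> {1..d} \<Longrightarrow> c \<in> {1..d} \<Longrightarrow>
    br (Pv B c) (Jv B a b) = kd a c *\<^sub>R Pv B b - kd b c *\<^sub>R Pv B a"
  "a \<in> {1..d} \<Longrightarrow> b \<in> {1..d} \<Longrightarrow> br (Hv B) (Jv B a b) = 0"
  "a \<in> {1..d} \<Longrightarrow> b \<in> {1..d} \<Longrightarrow> br (Dv B) (Jv B a b) = 0"
  "a \<in> {1..d} \<Longrightarrow> br (Hv B) (Pv B a) = 0"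
  "a \<in> {1..d} \<Longrightarrow> br (Pv B a) (Dv B) = - dp L *\<^sub>R Pv B a"
  "br (Hv B) (Dv B) = - dh L *\<^sub>R Hv B"
  using br_commute[of "Pv B c" "Jv B a b"] br_commute[of "Hv B" "Jv B a b"]
    br_commute[of "Dv B" "Jv B a b"] br_commute[of "Hv B" "Pv B a"]
    br_commute[of "Pv B a" "Dv B"] br_commute[of "Hv B" "Dv B"]
  by (simp_all add: br_J br_PP br_PH br_DP br_DH)

lemmas br_table = br_J br_PP br_PH br_DP br_DH br_rev

lemma eps2_kd: "eps2 a b = kd a 1 * kd b 2 - kd a 2 * kd b 1"
  by (auto simp: eps2_def kd_def)

lemma coord_br_P:
  assumes "c \<in> {1..d}"
  shows cJ_br_P: "m \<in> {1..d} \<Longrightarrow> n \<in> {1..d} \<Longrightarrow> cJ m n (br (Pv B c) x) =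
      pJ L * (kd c m * cP n x - kd c n * cP m x)"
    and cP_br_P: "n \<in> {1..d} \<Longrightarrow> cP n (br (Pv B c) x) = - cJ n c x - dp L * cD x * kd n c"
    and cH_br_P: "cH (br (Pv B c) x) = pH L * (kd c 1 * cP 2 x - kd c 2 * cP 1 x)"
    and cD_br_P: "cD (br (Pv B c) x) = 0"
proof -
  show "cJ m n (br (Pv B c) x) = pJ L * (kd c m * cP n x - kd c n * cP m x)"
    if "m \<in> {1..d}" "n \<in> {1..d}"
    by (rule linear_ext_basis)
      (use that assms in \<open>auto intro!: linearI simp: algebra_simps br_table kd_commute simp del: atLeastAtMost_iff\<close>)
  show "cP n (br (Pv B c) x) = - cJ n c x - dp L * cD x * kd n c" if "n \<in> {1..d}"
    by (rule linear_ext_basis)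
      (use that assms in \<open>auto intro!: linearI simp: algebra_simps br_table kd_commute simp del: atLeastAtMost_iff\<close>)
  show "cH (br (Pv B c) x) = pH L * (kd c 1 * cP 2 x - kd c 2 * cP 1 x)"
    by (rule linear_ext_basis)
      (use assms one_two_mem in \<open>auto intro!: linearI simp: algebra_simps br_table kd_commute eps2_kd
         simp del: atLeastAtMost_iff One_nat_def\<close>)
  show "cD (br (Pv B c) x) = 0"
    by (rule linear_ext_basis)
      (use assms in \<open>auto intro!: linearI simp: algebra_simps br_table simp del: atLeastAtMost_iff\<close>)
qed

lemma br_H: "br (Hv B) x = - (dh L * cD x) *\<^sub>R Hv B"
  by (rule linear_ext_basis)
    (auto intro!: linearI linear_br_right simp: br_table algebra_simps simp del: atLeastAtMost_iff)

lemma coord_br_D: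
  shows cJ_br_D: "m \<in> {1..d} \<Longrightarrow> n \<in> {1..d} \<Longrightarrow> cJ m n (br (Dv B) x) = 0"
    and cP_br_D: "n \<in> {1..d} \<Longrightarrow> cP n (br (Dv B) x) = dp L * cP n x"
    and cH_br_D: "cH (br (Dv B) x) = dh L * cH x"
    and cD_br_D: "cD (br (Dv B) x) = 0"
proof -
  show "cJ m n (br (Dv B) x) = 0" if "m \<in> {1..d}" "n \<in> {1..d}"
    by (rule linear_ext_basis)
      (use that in \<open>auto intro!: linearI simp: algebra_simps br_table simp del: atLeastAtMost_iff\<close>)
  show "cP n (br (Dv B) x) = dp L * cP n x" if "n \<in> {1..d}"
    by (rule linear_ext_basis)
      (use that in \<open>auto intro!: linearI simp: algebra_simps br_table simp del: atLeastAtMost_iff\<close>)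
  show "cH (br (Dv B) x) = dh L * cH x"
    by (rule linear_ext_basis)
      (auto intro!: linearI simp: algebra_simps br_table simp del: atLeastAtMost_iff)
  show "cD (br (Dv B) x) = 0"
    by (rule linear_ext_basis)
      (auto intro!: linearI simp: algebra_simps br_table simp del: atLeastAtMost_iff)
qed

text \<open>Write \<open>A_x\<close> for the matrix of \<open>cJ\<close> at \<open>x\<close> and
  \<open>p_x\<close> for the vector of \<open>cP\<close>. The right side is the matrix commutator of
  \<open>A_x\<close> and \<open>A_y\<close> plus \<open>pJ L\<close> times the wedge of
  \<open>p_x\<close> and \<open>p_y\<close>. By linearity only basis vectors \<open>x\<close> are
  checked, with \<open>y\<close> arbitrary.\<close>

lemma cJ_br:
  assumes mn: "m \<in> {1..d}" "n \<in> {1..d}"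
  shows "cJ m n (br x y) = (\<Sum>k\<in>{1..d}. cJ m k x * cJ k n y - cJ m k y * cJ k n x)
    + pJ L * (cP m x * cP n y - cP n x * cP m y)" (is "_ = ?g x")
proof (rule linear_ext_basis[where g = ?g], goal_cases)
  case (3 a b)
  have "(\<Sum>k\<in>{1..d}. cJ m k (Jv B a b) * cJ k n y - cJ m k y * cJ k n (Jv B a b)) =
     (\<Sum>k\<in>{1..d}. kd m a * (kd k b * cJ k n y) - kd m b * (kd k a * cJ k n y)
       - kd n b * (kd k a * cJ m k y) + kd n a * (kd k b * cJ m k y))"
    using 3 mn by (intro sum.cong) (auto simp: algebra_simps simp del: atLeastAtMost_iff)
  also have "\<dots> = kd m a * cJ b n y - kd m b * cJ a n y - kd n b * cJ m a y + kd n a * cJ m b y"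
    using 3 unfolding sum.distrib sum_subtractf sum_distrib_left[symmetric] by simp
  finally show ?case
    using 3 mn by (simp add: cJ_br_J kd_commute del: atLeastAtMost_iff)
next
  case (4 a)
  then show ?case using mn by (simp add: cJ_br_P kd_commute del: atLeastAtMost_iff)
qed (use mn in \<open>auto intro!: linearI simp: algebra_simps sum.distrib sum_distrib_left sum_subtractf
       br_H cJ_br_D simp del: atLeastAtMost_iff\<close>)

text \<open>In the same notation this is \<open>A_x p_y - A_y p_x\<close> plus the dilatation term
  carried by \<open>D\<close>.\<close>

lemma cP_br:
  assumes n: "n \<in> {1..d}"
  shows "cP n (br x y) = (\<Sum>k\<in>{1..d}. cJ n k x * cP k y - cJ n k y * cP k x)
    + dp L * (cD x * cP n y - cD y * cP n x)" (is "_ = ?g x")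
proof (rule linear_ext_basis[where g = ?g], goal_cases)
  case (3 a b)
  have "(\<Sum>k\<in>{1..d}. cJ n k (Jv B a b) * cP k y - cJ n k y * cP k (Jv B a b)) =
     (\<Sum>k\<in>{1..d}. kd n a * (kd k b * cP k y) - kd n b * (kd k a * cP k y))"
    using 3 n by (intro sum.cong) (auto simp: algebra_simps simp del: atLeastAtMost_iff)
  also have "\<dots> = kd n a * cP b y - kd n b * cP a y"
    using 3 unfolding sum_subtractf sum_distrib_left[symmetric] by simp
  finally show ?case
    using 3 n by (simp add: cP_br_J kd_commute del: atLeastAtMost_iff)
next
  case (4 a)
  have "(\<Sum>k\<in>{1..d}. cJ n k (Pv B a) * cP k y - cJ n k y * cP k (Pv B a)) =
     (\<Sum>k\<in>{1..d}. - (cJ n k y * kd k a))"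
    using 4 n by (intro sum.cong) (auto simp: algebra_simps simp del: atLeastAtMost_iff)
  also have "\<dots> = - cJ n a y"
    using 4 unfolding sum_negf by simp
  finally show ?case using 4 n by (simp add: cP_br_P kd_commute del: atLeastAtMost_iff)
qed (use n in \<open>auto intro!: linearI simp: algebra_simps sum.distrib sum_distrib_left sum_subtractf
       br_H cP_br_D simp del: atLeastAtMost_iff\<close>)

lemma cH_br: "cH (br x y) = pH L * (cP 1 x * cP 2 y - cP 2 x * cP 1 y)
    + dh L * (cD x * cH y - cD y * cH x)" (is "_ = ?g x")
  by (rule linear_ext_basis[where g = ?g])
    (use one_two_mem in \<open>auto intro!: linearI simp: algebra_simps cH_br_P cH_br_J br_H cH_br_D kd_commute
       simp del: atLeastAtMost_iff One_nat_def\<close>)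

lemma cD_br: "cD (br x y) = 0"
  by (rule linear_ext_basis)
    (auto intro!: linearI simp: cD_br_P cD_br_J br_H cD_br_D simp del: atLeastAtMost_iff)

lemmas coord_br = cJ_br cP_br cH_br cD_br

text \<open>The eigenvector equation is paired with \<open>y\<close> itself: its
  \<open>J\<close>-part with \<open>A_y\<close>, its \<open>P\<close>-part with \<open>p_y\<close>.
  The rotation part \<open>A_x\<close> drops out of both identities, and they share the mixed term
  \<open>q\<close>. Since sums of squares stand on the left, signs of \<open>pJ L\<close> decide
  which eigenvectors exist.\<close>

lemma br_eigen_norms:
  assumes eq: "br x y = c *\<^sub>R y"
  defines "q \<equiv> \<Sum>m\<in>{1..d}. \<Sum>n\<in>{1..d}. cP m x * cJ m n y * cP n y"
  shows "c * (\<Sum>m\<in>{1..d}. \<Sum>n\<in>{1..d}. (cJ m n y)\<^sup>2) = 2 * pJ L * q"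
    and "c * (\<Sum>n\<in>{1..d}. (cP n y)\<^sup>2) = q + dp L * cD x * (\<Sum>n\<in>{1..d}. (cP n y)\<^sup>2)
      - dp L * cD y * (\<Sum>n\<in>{1..d}. cP n x * cP n y)"
proof -
  let ?I = "{1..d}"
  \<comment> \<open>The antisymmetric \<open>A_x\<close> is contracted with the symmetric product of
    \<open>A_y\<close> and its transpose; the next sum vanishes in the same way with the factors in
    the other order.\<close>
  have 1: "(\<Sum>m\<in>?I. \<Sum>n\<in>?I. \<Sum>k\<in>?I. cJ m n y * (cJ m k x * cJ k n y)) = 0"
  proof -
    have "(\<Sum>m\<in>?I. \<Sum>n\<in>?I. \<Sum>k\<in>?I. cJ m n y * (cJ m k x * cJ k n y))
      = (\<Sum>m\<in>?I. \<Sum>k\<in>?I. \<Sum>n\<in>?I. cJ m n y * (cJ m k x * cJ k n y))"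
      by (intro sum.cong refl sum.swap)
    also have "\<dots> = (\<Sum>m\<in>?I. \<Sum>k\<in>?I. cJ m k x * (\<Sum>n\<in>?I. cJ m n y * cJ k n y))"
      by (simp add: sum_distrib_left mult_ac)
    also have "\<dots> = 0"
      by (rule sum_antisym_sym) (auto intro: cJ_commute sum.cong simp: mult.commute)
    finally show ?thesis .
  qed
  have 2: "(\<Sum>m\<in>?I. \<Sum>n\<in>?I. \<Sum>k\<in>?I. cJ m n y * (cJ m k y * cJ k n x)) = 0"
  proof -
    have "(\<Sum>m\<in>?I. \<Sum>n\<in>?I. \<Sum>k\<in>?I. cJ m n y * (cJ m k y * cJ k n x))
      = (\<Sum>n\<in>?I. \<Sum>m\<in>?I. \<Sum>k\<in>?I. cJ m n y * (cJ m k y * cJ k n x))"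
      by (rule sum.swap)
    also have "\<dots> = (\<Sum>n\<in>?I. \<Sum>k\<in>?I. \<Sum>m\<in>?I. cJ m n y * (cJ m k y * cJ k n x))"
      by (intro sum.cong refl sum.swap)
    also have "\<dots> = (\<Sum>n\<in>?I. \<Sum>k\<in>?I. cJ k n x * (\<Sum>m\<in>?I. cJ m n y * cJ m k y))"
      by (simp add: sum_distrib_left mult_ac)
    also have "\<dots> = 0"
      by (rule sum_antisym_sym) (auto intro: cJ_commute sum.cong simp: mult.commute)
    finally show ?thesis .
  qed
  have 3: "(\<Sum>m\<in>?I. \<Sum>n\<in>?I. cJ m n y * (cP n x * cP m y)) = - q"
  proof -
    have "(\<Sum>m\<in>?I. \<Sum>n\<in>?I. cJ m n y * (cP n x * cP m y))
      = (\<Sum>n\<in>?I. \<Sum>m\<in>?I. cJ m n y * (cP n x * cP m y))"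
      by (rule sum.swap)
    also have "\<dots> = (\<Sum>n\<in>?I. \<Sum>m\<in>?I. - (cP n x * cJ n m y * cP m y))"
      by (intro sum.cong refl) (metis cJ_commute mult.assoc mult.commute mult_minus_left)
    finally show ?thesis by (simp add: q_def sum_negf)
  qed
  have "c * (\<Sum>m\<in>?I. \<Sum>n\<in>?I. (cJ m n y)\<^sup>2) = (\<Sum>m\<in>?I. \<Sum>n\<in>?I. cJ m n y * cJ m n (br x y))"
    unfolding eq by (simp add: sum_distrib_left power2_eq_square mult_ac)
  also have "\<dots> = (\<Sum>m\<in>?I. \<Sum>n\<in>?I. (\<Sum>k\<in>?I. cJ m n y * (cJ m k x * cJ k n y))
      - (\<Sum>k\<in>?I. cJ m n y * (cJ m k y * cJ k n x))
      + (pJ L * (cP m x * cJ m n y * cP n y) - pJ L * (cJ m n y * (cP n x * cP m y))))"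
    by (intro sum.cong refl) (simp add: cJ_br sum_distrib_left sum_subtractf[symmetric] algebra_simps)
  also have "\<dots> = 2 * pJ L * q"
    unfolding sum.distrib sum_subtractf 1 2 using 3 by (simp add: q_def sum_distrib_left[symmetric])
  finally show "c * (\<Sum>m\<in>?I. \<Sum>n\<in>?I. (cJ m n y)\<^sup>2) = 2 * pJ L * q" .
  have 4: "(\<Sum>n\<in>?I. \<Sum>k\<in>?I. cP n y * (cJ n k x * cP k y)) = 0"
  proof -
    have "(\<Sum>n\<in>?I. \<Sum>k\<in>?I. cP n y * (cJ n k x * cP k y)) = (\<Sum>n\<in>?I. \<Sum>k\<in>?I. cJ n k x * (cP n y * cP k y))"
      by (simp add: mult_ac)
    also have "\<dots> = 0"
      by (rule sum_antisym_sym) (auto intro: cJ_commute)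
    finally show ?thesis .
  qed
  have 5: "(\<Sum>n\<in>?I. \<Sum>k\<in>?I. cP n y * (cJ n k y * cP k x)) = - q"
    unfolding 3[symmetric] by (simp add: mult_ac)
  have "c * (\<Sum>n\<in>?I. (cP n y)\<^sup>2) = (\<Sum>n\<in>?I. cP n y * cP n (br x y))"
    unfolding eq by (simp add: sum_distrib_left power2_eq_square mult_ac)
  also have "\<dots> = (\<Sum>n\<in>?I. (\<Sum>k\<in>?I. cP n y * (cJ n k x * cP k y)) - (\<Sum>k\<in>?I. cP n y * (cJ n k y * cP k x))
      + (dp L * cD x * (cP n y)\<^sup>2 - dp L * cD y * (cP n x * cP n y)))"
    by (intro sum.cong refl)
      (simp add: cP_br sum_distrib_left sum_subtractf[symmetric] algebra_simps power2_eq_square)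
  also have "\<dots> = q + dp L * cD x * (\<Sum>n\<in>?I. (cP n y)\<^sup>2) - dp L * cD y * (\<Sum>n\<in>?I. cP n x * cP n y)"
    unfolding sum.distrib sum_subtractf 4 5 by (simp add: sum_distrib_left)
  finally show "c * (\<Sum>n\<in>?I. (cP n y)\<^sup>2) = q + dp L * cD x * (\<Sum>n\<in>?I. (cP n y)\<^sup>2)
      - dp L * cD y * (\<Sum>n\<in>?I. cP n x * cP n y)" .
qed

lemma sum_squares_cJ_0: "(\<Sum>m\<in>{1..d}. \<Sum>n\<in>{1..d}. (cJ m n y)\<^sup>2) \<le> 0 \<Longrightarrow>
    m \<in> {1..d} \<Longrightarrow> n \<in> {1..d} \<Longrightarrow> cJ m n y = 0"
proof -
  assume *: "(\<Sum>m\<in>{1..d}. \<Sum>n\<in>{1..d}. (cJ m n y)\<^sup>2) \<le> 0" "m \<in> {1..d}" "n \<in> {1..d}"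
  have "(\<Sum>m\<in>{1..d}. \<Sum>n\<in>{1..d}. (cJ m n y)\<^sup>2) = 0"
    using * by (intro antisym sum_nonneg) auto
  then have "(\<Sum>n\<in>{1..d}. (cJ m n y)\<^sup>2) = 0"
    using * by (subst (asm) sum_nonneg_eq_0_iff) (auto intro: sum_nonneg)
  then show ?thesis
    using * by (subst (asm) sum_nonneg_eq_0_iff) auto
qed

lemma sum_squares_cP_0: "(\<Sum>n\<in>{1..d}. (cP n y)\<^sup>2) \<le> 0 \<Longrightarrow> n \<in> {1..d} \<Longrightarrow> cP n y = 0"
proof -
  assume *: "(\<Sum>n\<in>{1..d}. (cP n y)\<^sup>2) \<le> 0" "n \<in> {1..d}"
  have "(\<Sum>n\<in>{1..d}. (cP n y)\<^sup>2) = 0"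
    using * by (intro antisym sum_nonneg) auto
  then show ?thesis
    using * by (subst (asm) sum_nonneg_eq_0_iff) auto
qed

end

section \<open>Invariants separating the algebras in the list\<close>

definition has_centre :: "('v::real_vector \<Rightarrow> 'v \<Rightarrow> 'v) \<Rightarrow> bool" where
  "has_centre br \<longleftrightarrow> (\<exists>v. v \<noteq> 0 \<and> (\<forall>x. br x v = 0))"

definition derived_ideal1 :: "('v::real_vector \<Rightarrow> 'v \<Rightarrow> 'v) \<Rightarrow> bool" where
  "derived_ideal1 br \<longleftrightarrow>
    (\<exists>x y x' y'. br (br x y) (br x' y') \<noteq> 0 \<and> ideal1 br (br (br x y) (br x' y')))"

definition has_sandwich :: "('v::real_vector \<Rightarrow> 'v \<Rightarrow> 'v) \<Rightarrow> bool" where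
  "has_sandwich br \<longleftrightarrow> (\<exists>v. \<not> ideal1 br v \<and> (\<forall>x. br v (br v x) = 0))"

definition hyperbolic :: "('v::real_vector \<Rightarrow> 'v \<Rightarrow> 'v) \<Rightarrow> 'v \<Rightarrow> bool" where
  "hyperbolic br x \<longleftrightarrow> (\<exists>y. \<not> ideal1 br y \<and> br x y = y)"

context realisation
begin

text \<open>A rotation acts on \<open>v\<close> by a scalar, which \<open>br_eigen_norms\<close>
  forces to be zero unless \<open>v = 0\<close>. So \<open>v\<close> is rotation invariant, which
  removes its \<open>P\<close>-part. Then the \<open>P\<close>-part of the bracket of
  \<open>P_c\<close> with \<open>v\<close> must vanish too, which removes the \<open>J\<close>-part
  and, if \<open>dp L\<close> is nonzero, the \<open>D\<close>-part.\<close>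

lemma ideal1_coord:
  assumes v: "ideal1 br v"
  shows ideal1_cJ: "m \<in> {1..d} \<Longrightarrow> n \<in> {1..d} \<Longrightarrow> cJ m n v = 0"
    and ideal1_cP: "n \<in> {1..d} \<Longrightarrow> cP n v = 0"
    and ideal1_cD: "dp L * cD v = 0"
proof -
  have J0: "br (Jv B a b) v = 0" if ab: "a \<in> {1..d}" "b \<in> {1..d}" for a b
  proof -
    obtain c where c: "br (Jv B a b) v = c *\<^sub>R v"
      using v by (auto simp: ideal1_def)
    have "c * cH v = 0" "c * cD v = 0"
      using cH_br_J[OF ab, of v] cD_br_J[OF ab, of v] by (simp_all add: c)
    \<comment> \<open>With \<open>x = Jv B a b\<close> there is no \<open>P\<close>- or
      \<open>D\<close>-part in \<open>x\<close>, so every term on the right of the norm identities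
      is zero.\<close>
    moreover have "c * (\<Sum>m\<in>{1..d}. \<Sum>n\<in>{1..d}. (cJ m n v)\<^sup>2) = 0" "c * (\<Sum>n\<in>{1..d}. (cP n v)\<^sup>2) = 0"
      using br_eigen_norms[OF c] ab by simp_all
    ultimately have "v = 0" if "c \<noteq> 0"
      using that by (intro coord_eqI) (simp_all add: sum_squares_cJ_0 sum_squares_cP_0)
    then show ?thesis using c by auto
  qed
  show P0: "cP n v = 0" if n: "n \<in> {1..d}" for n
  proof -
    obtain a where a: "a \<in> {1..d}" "a \<noteq> n"
      using that[of "if n = 1 then 2 else 1"] one_two_mem by (auto split: if_splits)
    show ?thesis
      using cP_br_J[OF a(1) n a(1), of v] a J0[OF a(1) n] by simp
  qed
  have *: "cJ n c v + dp L * cD v * kd n c = 0" if nc: "n \<in> {1..d}" "c \<in> {1..d}" for n c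
  proof -
    obtain l where l: "br (Pv B c) v = l *\<^sub>R v"
      using v by (auto simp: ideal1_def)
    show ?thesis
      using cP_br_P[OF nc(2) nc(1), of v] P0[OF nc(1)] by (simp add: l)
  qed
  show D0: "dp L * cD v = 0"
    using *[OF one_two_mem(1) one_two_mem(1)] by simp
  show "cJ m n v = 0" if "m \<in> {1..d}" "n \<in> {1..d}"
    using *[OF that] by (simp add: D0)
qed

text \<open>A partial converse of \<open>ideal1_coord\<close>: such a \<open>v\<close> is a multiple
  of \<open>H\<close>, on which only \<open>D\<close> can act, with weight
  \<open>dh L\<close>.\<close>

lemma ideal1_scalar:
  assumes "\<And>m n. m \<in> {1..d} \<Longrightarrow> n \<in> {1..d} \<Longrightarrow> cJ m n v = 0"
    and "\<And>n. n \<in> {1..d} \<Longrightarrow> cP n v = 0" and "cD v = 0"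
  shows "ideal1 br v"
  unfolding ideal1_def
proof
  fix x
  have "br x v = (dh L * cD x) *\<^sub>R v"
    by (rule coord_eqI) (use assms one_two_mem in \<open>simp_all add: coord_br del: atLeastAtMost_iff One_nat_def\<close>)
  then show "\<exists>c. br x v = c *\<^sub>R v" by blast
qed

lemma ideal1_H: "ideal1 br (Hv B)"
  by (rule ideal1_scalar) simp_all

lemma H_nonzero: "Hv B \<noteq> 0"
  using cH_basis(3) coord_simps by (metis linear_0 linear_cH zero_neq_one)

lemma not_ideal1_P: "\<not> ideal1 br (Pv B 1)"
  using ideal1_cP[of "Pv B 1" 1] one_two_mem by auto

lemma has_centre_if:
  assumes "dh L = 0"
  shows "has_centre br"
proof -
  have "br x (Hv B) = 0" for x
    using br_commute[of x "Hv B"] by (simp add: br_H assms)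
  then show ?thesis
    unfolding has_centre_def using H_nonzero by blast
qed

lemma not_has_centre:
  assumes "dh L \<noteq> 0"
  shows "\<not> has_centre br"
  unfolding has_centre_def
proof clarify
  fix v assume v: "v \<noteq> 0" "\<forall>x. br x v = 0"
  then have i: "ideal1 br v"
    unfolding ideal1_def by (metis scaleR_zero_left)
  have "cH (br (Dv B) v) = 0" "cH (br (Hv B) v) = 0"
    using v by simp_all
  then have "cH v = 0" "cD v = 0"
    using assms by (simp_all add: cH_br_D br_H)
  then have "v = 0"
    by (intro coord_eqI) (simp_all add: ideal1_coord[OF i])
  then show False using v by simp
qed

lemma has_centre_iff: "has_centre br \<longleftrightarrow> dh L = 0"
  using has_centre_if not_has_centre by blast

text \<open>Brackets have no \<open>D\<close>-part, so in a bracket of two brackets an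
  \<open>H\<close>-part can only come from \<open>pH\<close>, and the weight \<open>dh\<close> is
  invisible. This is why the invariant uses a nested bracket. Being ideal excludes \<open>J\<close>-
  and \<open>P\<close>-parts. For the converse, rotations write \<open>P_1\<close> and
  \<open>P_2\<close> as brackets, up to sign.\<close>

lemma derived_ideal1_iff: "derived_ideal1 br \<longleftrightarrow> pH L \<noteq> 0"
proof
  assume "derived_ideal1 br"
  then obtain x y x' y' where v: "br (br x y) (br x' y') \<noteq> 0"
    and i: "ideal1 br (br (br x y) (br x' y'))"
    by (auto simp: derived_ideal1_def)
  show "pH L \<noteq> 0"
  proof
    assume "pH L = 0"
    then have "br (br x y) (br x' y') = 0"
      by (intro coord_eqI) (simp_all add: ideal1_coord[OF i] cH_br cD_br)
    then show False using v by simp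
  qed
next
  assume e: "pH L \<noteq> 0"
  then have "pJ L = 0" by (cases L) auto
  then have "br (br (Jv B 1 2) (Pv B 2)) (br (Jv B 1 2) (Pv B 1)) = (- pH L) *\<^sub>R Hv B"
    using one_two_mem by (simp add: br_J br_PP eps2_def del: atLeastAtMost_iff One_nat_def)
  moreover have "ideal1 br ((- pH L) *\<^sub>R Hv B)"
    by (rule ideal1_scalar) simp_all
  ultimately show "derived_ideal1 br"
    unfolding derived_ideal1_def using e H_nonzero
    by (metis neg_equal_0_iff_equal scaleR_eq_0_iff)
qed

lemma has_sandwich_if:
  assumes "pJ L = 0" "pH L = 0"
  shows "has_sandwich br"
proof -
  have "br (Pv B 1) (br (Pv B 1) x) = 0" for x
    by (rule coord_eqI) (use assms one_two_mem in \<open>simp_all add: coord_br_P del: atLeastAtMost_iff One_nat_def\<close>)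
  then show ?thesis
    unfolding has_sandwich_def using not_ideal1_P by blast
qed

text \<open>With \<open>A\<close> and \<open>p\<close> for the \<open>J\<close>- and
  \<open>P\<close>-parts of \<open>v\<close>, the equations \<open>E1\<close> and \<open>E2\<close>
  from applying \<open>ad v\<close> twice to \<open>P_c\<close> give \<open>A p = 0\<close>, then
  \<open>p = 0\<close>, then \<open>A = 0\<close>. What is left lies in the span of \<open>H\<close>
  and \<open>D\<close>, and turns out to be ideal.\<close>

lemma not_has_sandwich:
  assumes s: "pJ L \<noteq> 0"
  shows "\<not> has_sandwich br"
  unfolding has_sandwich_def
proof clarify
  fix v
  assume ni: "\<not> ideal1 br v" and sq: "\<forall>x. br v (br v x) = 0"
  have "dp L = 0" "pH L = 0" using s by (cases L; simp)+
  let ?I = "{1..d}"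
  let ?A = "\<lambda>m n. cJ m n v" and ?p = "\<lambda>n. cP n v"
  define w where "w m = (\<Sum>k\<in>?I. ?A m k * ?p k)" for m
  define N where "N = (\<Sum>k\<in>?I. (?p k)\<^sup>2)"
  have vP: "br v (Pv B c) = - br (Pv B c) v" for c
    by (rule br_commute)
  have cJ_vP: "cJ m n (br v (Pv B c)) = pJ L * (?p m * kd n c - ?p n * kd m c)"
    if "m \<in> ?I" "n \<in> ?I" "c \<in> ?I" for m n c
    using that by (simp add: vP cJ_br_P kd_commute algebra_simps del: atLeastAtMost_iff)
  have cP_vP: "cP n (br v (Pv B c)) = ?A n c" if "n \<in> ?I" "c \<in> ?I" for n c
    using that by (simp add: vP cP_br_P \<open>dp L = 0\<close> del: atLeastAtMost_iff)
  \<comment> \<open>The \<open>P\<close>-component of \<open>[v,[v,P\<^sub>c]] = 0\<close>: the square of the matrix \<open>A\<close> is \<open>s (p p\<^sup>T - |p|\<^sup>2)\<close>.\<close>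
  have E1: "(\<Sum>k\<in>?I. ?A n k * ?A k c) = pJ L * (?p n * ?p c - N * kd n c)"
    if nc: "n \<in> ?I" "c \<in> ?I" for n c
  proof -
    have "0 = cP n (br v (br v (Pv B c)))" using sq by simp
    also have "\<dots> = (\<Sum>k\<in>?I. ?A n k * ?A k c - pJ L * (?p n * (kd k c * ?p k)) + pJ L * (kd n c * (?p k)\<^sup>2))"
      unfolding cP_br[OF nc(1)] \<open>dp L = 0\<close> using nc
      by (auto intro!: sum.cong simp: cP_vP cJ_vP algebra_simps power2_eq_square simp del: atLeastAtMost_iff)
    also have "\<dots> = (\<Sum>k\<in>?I. ?A n k * ?A k c) - pJ L * (?p n * ?p c - N * kd n c)"
      unfolding sum.distrib sum_subtractf sum_distrib_left[symmetric] N_def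
      using nc by (simp add: algebra_simps del: atLeastAtMost_iff)
    finally show ?thesis by simp
  qed
  \<comment> \<open>The \<open>J\<close>-component of the same double bracket, divided by
    \<open>pJ L\<close>; here \<open>w\<close> is \<open>A p\<close>.\<close>
  have E2: "w m * kd n c - w n * kd m c + 2 * (?p m * ?A n c - ?p n * ?A m c) = 0"
    if nc: "m \<in> ?I" "n \<in> ?I" "c \<in> ?I" for m n c
  proof -
    have "0 = cJ m n (br v (br v (Pv B c)))" using sq by simp
    also have "\<dots> = (\<Sum>k\<in>?I. pJ L * (kd n c * (?A m k * ?p k)) - pJ L * (?p n * (?A m k * kd k c))
        - pJ L * (?p m * (kd k c * ?A k n)) + pJ L * (kd m c * (?p k * ?A k n)))
        + pJ L * (?p m * ?A n c - ?p n * ?A m c)"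
      unfolding cJ_br[OF nc(1,2)] using nc
      by (auto intro!: sum.cong simp: cP_vP cJ_vP algebra_simps simp del: atLeastAtMost_iff)
    also have "\<dots> = pJ L * (kd n c * w m - ?p n * ?A m c - ?p m * ?A c n
        + kd m c * (\<Sum>k\<in>?I. ?p k * ?A k n) + ?p m * ?A n c - ?p n * ?A m c)"
      unfolding sum.distrib sum_subtractf sum_distrib_left[symmetric] w_def
      using nc by (simp add: algebra_simps del: atLeastAtMost_iff)
    also have "(\<Sum>k\<in>?I. ?p k * ?A k n) = - w n"
      unfolding w_def sum_negf[symmetric]
    proof (intro sum.cong refl)
      show "?p k * ?A k n = - (?A n k * ?p k)" for k
        using cJ_commute[of k n v] by simp
    qed
    also have "?A c n = - ?A n c" by (rule cJ_commute)
    finally have "pJ L * (w m * kd n c - w n * kd m c + 2 * (?p m * ?A n c - ?p n * ?A m c)) = 0"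
      by (simp add: algebra_simps)
    then show ?thesis using s by simp
  qed
  \<comment> \<open>Antisymmetry turns the squared norm of \<open>A p\<close> into the pairing of
    \<open>-p\<close> with \<open>A (A p)\<close>, and \<open>E1\<close> applied to \<open>p\<close>
    gives \<open>A (A p) = 0\<close>.\<close>
  have w0: "w m = 0" if m: "m \<in> ?I" for m
  proof -
    have "(\<Sum>m\<in>?I. (w m)\<^sup>2) = (\<Sum>m\<in>?I. \<Sum>k\<in>?I. ?A m k * ?p k * w m)"
      by (simp add: power2_eq_square w_def sum_distrib_right)
    also have "\<dots> = (\<Sum>k\<in>?I. \<Sum>m\<in>?I. ?A m k * ?p k * w m)"
      by (rule sum.swap)
    also have "\<dots> = (\<Sum>k\<in>?I. - (?p k * (\<Sum>m\<in>?I. ?A k m * w m)))"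
      unfolding sum_distrib_left sum_negf[symmetric]
    proof (intro sum.cong refl)
      show "?A m k * ?p k * w m = - (?p k * (?A k m * w m))" for k m
        using cJ_commute[of m k v] by simp
    qed
    also have "\<dots> = (\<Sum>k\<in>?I. 0)"
    proof (intro sum.cong refl)
      fix k assume k: "k \<in> ?I"
      have "(\<Sum>m\<in>?I. ?A k m * w m) = (\<Sum>m\<in>?I. \<Sum>j\<in>?I. ?A k m * ?A m j * ?p j)"
        by (simp add: w_def sum_distrib_left mult.assoc)
      also have "\<dots> = (\<Sum>j\<in>?I. \<Sum>m\<in>?I. ?A k m * ?A m j * ?p j)"
        by (rule sum.swap)
      also have "\<dots> = (\<Sum>j\<in>?I. pJ L * (?p k * (?p j)\<^sup>2) - pJ L * (N * (kd k j * ?p j)))"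
        unfolding sum_distrib_right[symmetric]
      proof (intro sum.cong refl)
        fix j assume "j \<in> ?I"
        from E1[OF k this] show "(\<Sum>m\<in>?I. ?A k m * ?A m j) * ?p j =
            pJ L * (?p k * (?p j)\<^sup>2) - pJ L * (N * (kd k j * ?p j))"
          by (simp only:) (simp add: power2_eq_square algebra_simps)
      qed
      also have "\<dots> = 0"
        unfolding sum_subtractf sum_distrib_left[symmetric] N_def[symmetric] using k by simp
      finally show "- (?p k * (\<Sum>m\<in>?I. ?A k m * w m)) = 0" by simp
    qed
    finally have "(\<Sum>m\<in>?I. (w m)\<^sup>2) = 0" by simp
    then show ?thesis using m by (subst (asm) sum_nonneg_eq_0_iff) auto
  qed
  \<comment> \<open>Once \<open>w\<close> is zero, \<open>E2\<close> is contracted with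
    \<open>p\<close> over the index \<open>m\<close>.\<close>
  have "N * ?A n c = 0" if nc: "n \<in> ?I" "c \<in> ?I" for n c
  proof -
    have "N * ?A n c = (\<Sum>m\<in>?I. ?p m * (?p m * ?A n c))"
      by (simp add: N_def sum_distrib_right power2_eq_square mult.assoc)
    also have "\<dots> = (\<Sum>m\<in>?I. - (?p n * (?A c m * ?p m)))"
    proof (intro sum.cong refl)
      fix m assume m: "m \<in> ?I"
      have "?p m * ?A n c = ?p n * ?A m c" using E2[OF m nc] w0 m nc by simp
      then show "?p m * (?p m * ?A n c) = - (?p n * (?A c m * ?p m))"
        using cJ_commute[of m c v] by (simp add: mult_ac)
    qed
    also have "\<dots> = - (?p n * w c)"
      by (simp add: w_def sum_distrib_left sum_negf)
    finally show ?thesis using w0 nc by simp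
  qed
  have N0: "N = 0"
  proof (rule ccontr)
    assume "N \<noteq> 0"
    then have "?A n c = 0" if "n \<in> ?I" "c \<in> ?I" for n c
      using that \<open>\<And>n c. \<lbrakk>n \<in> ?I; c \<in> ?I\<rbrakk> \<Longrightarrow> N * ?A n c = 0\<close> by simp
    \<comment> \<open>The diagonal of \<open>E1\<close> with \<open>A = 0\<close>. Summing over the
      \<open>d\<close> values of \<open>n\<close> would give \<open>N = d * N\<close>, impossible
      for \<open>d\<close> at least 2.\<close>
    then have "(?p n)\<^sup>2 = N" if "n \<in> ?I" for n
      using E1[OF that that] that s by (simp add: power2_eq_square)
    then have "N = (\<Sum>n\<in>?I. N)"
      by (subst N_def) (rule sum.cong, auto)
    then have "N * (real d - 1) = 0" by (simp add: algebra_simps)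
    then show False using d_ge_2 \<open>N \<noteq> 0\<close> by simp
  qed
  have p0: "?p n = 0" if "n \<in> ?I" for n
    using sum_squares_cP_0[of v n] N0 that by (simp add: N_def)
  have A0: "?A n c = 0" if nc: "n \<in> ?I" "c \<in> ?I" for n c
  proof -
    \<comment> \<open>By antisymmetry the squared norm of a column is minus a diagonal entry of the
      square of \<open>A\<close>, which is zero by \<open>E1\<close> and
      \<open>p = 0\<close>.\<close>
    have "(\<Sum>k\<in>?I. (?A k c)\<^sup>2) = - (\<Sum>k\<in>?I. ?A c k * ?A k c)"
      unfolding sum_negf[symmetric]
    proof (intro sum.cong refl)
      show "(?A k c)\<^sup>2 = - (?A c k * ?A k c)" for k
        using cJ_commute[of c k v] by (simp add: power2_eq_square)
    qed
    also have "\<dots> = 0" using E1[OF nc(2) nc(2)] p0 nc N0 by simp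
    finally show ?thesis using nc by (subst (asm) sum_nonneg_eq_0_iff) auto
  qed
  show False
  proof (cases "dh L = 0")
    case True
    then have "br x v = 0" for x
      by (intro coord_eqI)
        (simp_all add: coord_br A0 p0 \<open>dp L = 0\<close> \<open>pH L = 0\<close>)
    then show ?thesis using ni by (simp add: ideal1_def)
  next
    case False
    \<comment> \<open>This coordinate is the square of \<open>dh L * cD v\<close>.\<close>
    have "cH (br v (br v (Hv B))) = 0" using sq by simp
    then have "cD v = 0"
      using False by (simp add: cH_br cD_br \<open>pH L = 0\<close>)
    then show ?thesis using ni ideal1_scalar A0 p0 by blast
  qed
qed

text \<open>With eigenvalue 1 and \<open>dp L = 0\<close> the two norm identities combine: the
  squared norm of \<open>A_y\<close> is \<open>2 * pJ L\<close> times that of \<open>p_y\<close>,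
  hence not positive. So the \<open>J\<close>-part vanishes, then \<open>q\<close>, then the
  \<open>P\<close>-part, and \<open>y\<close> is a multiple of \<open>H\<close>.\<close>

lemma not_hyperbolic:
  assumes s: "pJ L \<le> 0" and "dp L = 0"
  shows "\<not> hyperbolic br x"
  unfolding hyperbolic_def
proof clarify
  fix y assume ni: "\<not> ideal1 br y" and eq: "br x y = y"
  have "cD y = 0" using cD_br[of x y] eq by simp
  have eq': "br x y = 1 *\<^sub>R y" using eq by simp
  note norms = br_eigen_norms[OF eq']
  have P: "0 \<le> (\<Sum>n\<in>{1..d}. (cP n y)\<^sup>2)" by (intro sum_nonneg) auto
  then have "(\<Sum>m\<in>{1..d}. \<Sum>n\<in>{1..d}. (cJ m n y)\<^sup>2) \<le> 0"
    using norms s \<open>dp L = 0\<close> mult_nonpos_nonneg[OF s P] by simp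
  then have J0: "cJ m n y = 0" if "m \<in> {1..d}" "n \<in> {1..d}" for m n
    using that sum_squares_cJ_0 by blast
  then have "(\<Sum>n\<in>{1..d}. (cP n y)\<^sup>2) \<le> 0"
    using norms(2) \<open>dp L = 0\<close> by simp
  then show False
    using ni J0 \<open>cD y = 0\<close> ideal1_scalar sum_squares_cP_0 by blast
qed

lemma hyperbolic_P:
  assumes "pJ L = 1" "pH L = 0"
  shows "hyperbolic br (Pv B 1)"
proof -
  \<comment> \<open>For the positive sign \<open>P_1\<close> acts as a boost, exchanging
    \<open>P_2\<close> and \<open>J_12\<close>; their sum is the eigenvector for eigenvalue
    1.\<close>
  let ?y = "Jv B 1 2 + Pv B 2"
  have "br (Pv B 1) ?y = ?y"
    using one_two_mem assms by (simp add: br_table del: atLeastAtMost_iff One_nat_def)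
  moreover have "cP 2 ?y = 1"
    using one_two_mem by simp
  then have "\<not> ideal1 br ?y"
    using ideal1_cP one_two_mem by fastforce
  ultimately show ?thesis unfolding hyperbolic_def by blast
qed

lemma hyperbolic_D:
  assumes "dp L = 1"
  shows "hyperbolic br (Dv B)"
  unfolding hyperbolic_def using not_ideal1_P one_two_mem assms br_DP[of 1] by auto

text \<open>The first norm identity kills the \<open>J\<close>-part of \<open>y\<close>, so the
  second compares the squared norm of \<open>p_y\<close> with \<open>cD x\<close> times itself. That
  norm is nonzero because \<open>y\<close> is not ideal.\<close>

lemma hyperbolic_cD:
  assumes "pJ L = 0" "dp L = 1" "hyperbolic br x"
  shows "cD x = 1"
proof -
  obtain y where ni: "\<not> ideal1 br y" and eq: "br x y = y"
    using assms by (auto simp: hyperbolic_def)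
  have "cD y = 0" using cD_br[of x y] eq by simp
  have eq': "br x y = 1 *\<^sub>R y" using eq by simp
  note norms = br_eigen_norms[OF eq']
  have J0: "cJ m n y = 0" if "m \<in> {1..d}" "n \<in> {1..d}" for m n
    using sum_squares_cJ_0[of y m n] norms(1) assms that by simp
  have "(\<Sum>n\<in>{1..d}. (cP n y)\<^sup>2) \<noteq> 0"
    using ni J0 \<open>cD y = 0\<close> ideal1_scalar sum_squares_cP_0 by (metis order_refl)
  then show ?thesis
    using norms(2) J0 \<open>cD y = 0\<close> assms by simp
qed

text \<open>Here \<open>v\<close> is a multiple of \<open>H\<close> and \<open>x\<close> has
  \<open>D\<close>-coefficient 1. The weight is thus expressed without reference to a basis, which
  makes the parameter \<open>z\<close> an invariant.\<close>

lemma ideal1_weight: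
  assumes "pJ L = 0" "dp L = 1" "hyperbolic br x" "ideal1 br v"
  shows "br x v = dh L *\<^sub>R v"
proof (rule coord_eqI)
  have "cD v = 0" using ideal1_cD[OF assms(4)] assms by simp
  then show "cH (br x v) = cH (dh L *\<^sub>R v)" "cD (br x v) = cD (dh L *\<^sub>R v)"
    using ideal1_cP[OF assms(4)] hyperbolic_cD assms one_two_mem by (simp_all add: cH_br cD_br)
  show "cP n (br x v) = cP n (dh L *\<^sub>R v)" if "n \<in> {1..d}" for n
    using ideal1_coord[OF assms(4)] \<open>cD v = 0\<close> that by (simp add: cP_br)
  show "cJ m n (br x v) = cJ m n (dh L *\<^sub>R v)" if "m \<in> {1..d}" "n \<in> {1..d}" for m n
    using ideal1_coord[OF assms(4)] that by (simp add: cJ_br)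
qed

end

section \<open>Uniqueness of the label\<close>

lemma sgn_of_eq: "sgn_of s = (if s then 1 else - 1)"
  by (cases s) auto

text \<open>Both labels are read off the same bracket \<open>br\<close>, so each invariant takes one
  value and is computed from either basis.\<close>

lemma realises_unique:
  fixes br :: "'v::real_vector \<Rightarrow> 'v \<Rightarrow> 'v"
  assumes "2 \<le> d" "realises d L br B" "realises d L' br B'"
  shows "L = L'"
proof -
  interpret R: realisation d L B br by unfold_locales (rule assms)+
  interpret R': realisation d L' B' br by unfold_locales (rule assms)+
  have H: "pH L = 0 \<longleftrightarrow> pH L' = 0" using R.derived_ideal1_iff R'.derived_ideal1_iff by blast
  have C: "dh L = 0 \<longleftrightarrow> dh L' = 0" using R.has_centre_iff R'.has_centre_iff by blast
  show ?thesis
  proof (cases "pH L = 0")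
    case False
    then show ?thesis using H C by (cases L; cases L'; simp)
  next
    case True
    then have H0: "pH L = 0" "pH L' = 0" using H by auto
    have J: "pJ L = 0 \<longleftrightarrow> pJ L' = 0"
      using R.has_sandwich_if R'.has_sandwich_if R.not_has_sandwich R'.not_has_sandwich H0 by blast
    have hyp: "(\<exists>x. hyperbolic br x) \<longleftrightarrow> pJ l = 1 \<or> dp l = 1" if "realisation d l b br" "pH l = 0" for l b
    proof -
      interpret l: realisation d l b br by fact
      have "(pJ l = 1 \<or> dp l = 1) \<or> (pJ l \<le> 0 \<and> dp l = 0)"
        by (cases l) (auto simp: sgn_of_eq)
      then show ?thesis
        using l.hyperbolic_P l.hyperbolic_D l.not_hyperbolic that by blast
    qed
    have Q: "pJ L = 1 \<or> dp L = 1 \<longleftrightarrow> pJ L' = 1 \<or> dp L' = 1"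
      using hyp[OF R.realisation_axioms] hyp[OF R'.realisation_axioms] H0 by blast
    show ?thesis
    proof (cases "pJ L = 0 \<and> dp L = 1")
      case True
      then have 1: "pJ L = 0" "dp L = 1" "pJ L' = 0" "dp L' = 1"
        using J Q by auto
      \<comment> \<open>The hyperbolic vector and the ideal vector come from the first basis, the
        weight formula from the second.\<close>
      have "br (Dv B) (Hv B) = dh L' *\<^sub>R Hv B"
        by (rule R'.ideal1_weight[OF 1(3,4) R.hyperbolic_D[OF 1(2)] R.ideal1_H])
      then have "dh L = dh L'" using R.br_DH R.H_nonzero by simp
      then show ?thesis using 1 H0 by (cases L; cases L'; simp)
    next
      case False
      \<comment> \<open>Remaining are \<open>A1\<close>, \<open>A2\<close>, \<open>A4\<close>,
        \<open>A5\<close>: \<open>J\<close> separates the two pairs, \<open>Q\<close> finds the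
        sign, \<open>C\<close> separates within a pair.\<close>
      show ?thesis
        using False H0 J Q C by (cases L; cases L') (auto simp: sgn_of_eq split: if_splits)
    qed
  qed
qed

text \<open>The basis is carried back along the inverse of \<open>f\<close>. This replaces
  isomorphisms between algebras by bases of a single algebra.\<close>

lemma realises_pullback:
  fixes br br' :: "'v::real_vector \<Rightarrow> 'v \<Rightarrow> 'v"
  assumes lie: "lie_algebra br" and L: "realises d L br' B'" and f: "lie_iso br br' f"
  shows "\<exists>B. realises d L br B"
proof -
  define g where "g = inv f"
  have "linear f" "bij f" and hom: "\<And>x y. f (br x y) = br' (f x) (f y)"
    using f by (auto simp: lie_iso_def)
  have fg: "f (g x) = x" and gf: "g (f x) = x" for x
    using \<open>bij f\<close> by (auto simp: g_def bij_def surj_f_inv_f)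
  have lin: "linear g"
  proof (rule linearI)
    show "g (x + y) = g x + g y" for x y
      using linear_add[OF \<open>linear f\<close>, of "g x" "g y"] gf[of "g x + g y"] by (simp add: fg)
    show "g (c *\<^sub>R x) = c *\<^sub>R g x" for c x
      using linear_scale[OF \<open>linear f\<close>, of c "g x"] gf[of "c *\<^sub>R g x"] by (simp add: fg)
  qed
  have injg: "inj g" using fg by (metis injI)
  have hom': "br (g x) (g y) = g (br' x y)" for x y
    using hom[of "g x" "g y"] gf[of "br (g x) (g y)"] by (simp add: fg)
  define B where "B = g \<circ> B'"
  have "independent (B ` Idx d)"
    unfolding B_def image_comp[symmetric]
    using L injg by (intro linear_independent_injective_image lin) (auto simp: realises_def is_basis_def)
  moreover have "span (B ` Idx d) = UNIV"
    unfolding B_def image_comp[symmetric] linear_span_image[OF lin]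
    using L surjI[of g f, OF gf] by (simp add: realises_def is_basis_def)
  moreover have "inj_on B (Idx d)"
    unfolding B_def using L injg by (auto simp: realises_def is_basis_def inj_on_def)
  ultimately have basis: "is_basis d B" by (simp add: is_basis_def)
  have J: "Jv B a b = g (Jv B' a b)" for a b
    by (simp add: Jv_def B_def linear_neg[OF lin] linear_0[OF lin])
  have Bg: "B i = g (B' i)" for i by (simp add: B_def)
  have pp: "pp L B a b = g (pp L B' a b)" for a b
    by (cases L) (simp_all add: J Bg linear_scale[OF lin] linear_0[OF lin])
  note gl = linear_add[OF lin, symmetric] linear_diff[OF lin, symmetric] linear_scale[OF lin, symmetric]
  have "common_brackets d br B"
    using L unfolding realises_def common_brackets_def J Bg hom'
    by (simp add: gl linear_0[OF lin])
  then have "realises d L br B"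
    using L lie basis unfolding realises_def Bg hom' pp
    by (simp add: gl linear_0[OF lin])
  then show ?thesis by blast
qed

section \<open>Equivariance under rotations\<close>

lemma exists_index_notin:
  assumes "finite S" "card S < d"
  shows "\<exists>c\<in>{1..d}. c \<notin> S"
proof (rule ccontr)
  assume "\<not> ?thesis"
  then have "{1..d} \<subseteq> S" by blast
  then have "card {1..d} \<le> card S" using assms by (intro card_mono) auto
  then show False using assms by simp
qed

lemma exists_third_index:
  fixes a b :: nat
  assumes "3 \<le> d"
  obtains c where "c \<in> {1..d}" "c \<noteq> a" "c \<noteq> b"
  using exists_index_notin[of "{a, b}" d] assms card_insert_le_m1[of 2 "{b}" a] by auto

lemma exists_fourth_index:
  fixes a b n :: nat
  assumes "4 \<le> d"
  obtains c where "c \<in> {1..d}" "c \<noteq> a" "c \<noteq> b" "c \<noteq> n"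
proof -
  have "card {a, b, n} \<le> 3"
    by (metis card.empty card_insert_le_m1 diff_Suc_1 finite.emptyI le_refl numeral_3_eq_3 zero_less_Suc)
  then show ?thesis
    using exists_index_notin[of "{a, b, n}" d] assms that by auto
qed

context indexed_basis
begin

text \<open>For \<open>d = 3\<close> the \<open>J\<^sub>a\<^sub>b\<close> form a second vector \<open>\<epsilon>\<^sub>c\<^sub>a\<^sub>b J\<^sub>a\<^sub>b / 2\<close>, which can mix with \<open>P\<^sub>c\<close>.\<close>

definition dualJ :: "nat \<Rightarrow> 'v" where
  "dualJ c = (if c = 1 then Jv B 2 3 else if c = 2 then Jv B 3 1 else Jv B 1 2)"

end

context lifshitz_algebra
begin

lemma br_PJ: "a \<in> {1..d} \<Longrightarrow> b \<in> {1..d} \<Longrightarrow> c \<in> {1..d} \<Longrightarrow>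
    br (Pv B c) (Jv B a b) = kd a c *\<^sub>R Pv B b - kd b c *\<^sub>R Pv B a"
  and br_HJ: "a \<in> {1..d} \<Longrightarrow> b \<in> {1..d} \<Longrightarrow> br (Hv B) (Jv B a b) = 0"
  and br_DJ: "a \<in> {1..d} \<Longrightarrow> b \<in> {1..d} \<Longrightarrow> br (Dv B) (Jv B a b) = 0"
  using br_commute[of "Pv B c" "Jv B a b"] br_commute[of "Hv B" "Jv B a b"]
    br_commute[of "Dv B" "Jv B a b"]
  by (simp_all add: br_J)

context
  fixes X :: "nat \<Rightarrow> 'v"
  assumes X: "\<And>a b c. \<lbrakk>a \<in> {1..d}; b \<in> {1..d}; c \<in> {1..d}\<rbrakk> \<Longrightarrow>
    br (Jv B a b) (X c) = kd b c *\<^sub>R X a - kd a c *\<^sub>R X b"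
begin

text \<open>Any \<open>c\<close> different from \<open>a\<close> may be chosen, and a good choice
  makes the unwanted coordinates of the rotated vector vanish at once.\<close>

lemma vector_rotate: "a \<in> {1..d} \<Longrightarrow> c \<in> {1..d} \<Longrightarrow> a \<noteq> c \<Longrightarrow> X a = br (Jv B a c) (X c)"
  using X[of a c c] by simp

lemma vector_scalar: 
  assumes a: "a \<in> {1..d}"
  shows vector_cH: "cH (X a) = 0" and vector_cD: "cD (X a) = 0"
proof -
  obtain c where "c \<in> {1..d}" "a \<noteq> c"
    using that[of "if a = 1 then 2 else 1"] one_two_mem by (auto split: if_splits)
  then have "X a = br (Jv B a c) (X c)" using a vector_rotate by blast
  then show "cH (X a) = 0" "cD (X a) = 0"
    using cH_br_J cD_br_J a \<open>c \<in> {1..d}\<close> by auto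
qed

lemma vector_cP_diag: "a \<in> {1..d} \<Longrightarrow> c \<in> {1..d} \<Longrightarrow> cP a (X a) = cP c (X c)"
  using vector_rotate[of a c] cP_br_J[of a c a "X c"] by (cases "a = c") auto

lemma vector_cP_off:
  assumes "a \<in> {1..d}" "n \<in> {1..d}" "a \<noteq> n" "3 \<le> d"
  shows "cP n (X a) = 0"
proof -
  obtain c where "c \<in> {1..d}" "c \<noteq> a" "c \<noteq> n"
    using exists_third_index[OF \<open>3 \<le> d\<close>] by metis
  then show ?thesis
    using assms vector_rotate[of a c] cP_br_J[of a c n "X c"] by auto
qed

lemma vector_cJ_self: "a \<in> {1..d} \<Longrightarrow> n \<in> {1..d} \<Longrightarrow> cJ a n (X a) = 0"
  using vector_rotate[of a n] cJ_br_J[of a n a n "X n"] by (cases "a = n") auto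

text \<open>If \<open>a\<close>, \<open>m\<close>, \<open>n\<close> are distinct, a fourth index
  \<open>c\<close> is available, and the rotation in the plane of \<open>a\<close> and
  \<open>c\<close> contributes nothing to the entry at \<open>m\<close>, \<open>n\<close>.\<close>

lemma vector_cJ_ge_4:
  assumes "4 \<le> d" "a \<in> {1..d}" "m \<in> {1..d}" "n \<in> {1..d}"
  shows "cJ m n (X a) = 0"
proof (cases "m = a \<or> n = a")
  case True
  then show ?thesis
    using vector_cJ_self[OF assms(2,3)] vector_cJ_self[OF assms(2,4)] cJ_commute[of m n "X a"] by auto
next
  case False
  obtain c where "c \<in> {1..d}" "c \<noteq> a" "c \<noteq> m" "c \<noteq> n"
    using exists_fourth_index[OF \<open>4 \<le> d\<close>] by metis
  then show ?thesis
    using assms False vector_rotate[of a c] cJ_br_J[of a c m n "X c"] by auto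
qed

text \<open>This is a case of Schur's lemma: from dimension 4 on, \<open>P\<close> is the only copy
  of the vector representation.\<close>

lemma vector_ge_4:
  assumes "4 \<le> d" 
  shows "\<exists>k. \<forall>a\<in>{1..d}. X a = k *\<^sub>R Pv B a"
proof (intro exI ballI)
  fix a assume a: "a \<in> {1..d}"
  show "X a = cP 1 (X 1) *\<^sub>R Pv B a"
  proof (rule coord_eqI)
    fix n assume "n \<in> {1..d}"
    then show "cP n (X a) = cP n (cP 1 (X 1) *\<^sub>R Pv B a)"
      using a assms one_two_mem vector_cP_diag[of a 1] vector_cP_off[of a n] by (cases "a = n") auto
  qed (use a assms vector_scalar vector_cJ_ge_4 in auto)
qed

lemma vector_3:
  assumes "d = 3"
  shows "\<exists>k l. \<forall>a\<in>{1..d}. X a = k *\<^sub>R Pv B a + l *\<^sub>R dualJ a"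
proof (intro exI ballI)
  have I: "n \<in> {1..d} \<longleftrightarrow> n = 1 \<or> n = 2 \<or> n = 3" for n
    using assms by auto
  then have three: "3 \<in> {1..d}" "3 \<le> d" by auto
  fix a assume a: "a \<in> {1..d}"
  define l where "l = cJ 2 3 (X 1)"
  have "X 1 = br (Jv B 1 2) (X 2)" "X 2 = br (Jv B 2 3) (X 3)"
    by (rule vector_rotate; simp add: I del: atLeastAtMost_iff One_nat_def)+
  then have 1: "cJ 3 1 (X 2) = l" "cJ 1 2 (X 3) = l"
    using cJ_br_J[of 1 2 2 3 "X 2"] cJ_br_J[of 2 3 3 1 "X 3"] cJ_commute[of 1 3 "X 2"]
      cJ_commute[of 1 2 "X 3"]
    by (simp_all add: I l_def del: atLeastAtMost_iff One_nat_def)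
  have self: "cJ 1 2 (X 1) = 0" "cJ 1 3 (X 1) = 0" "cJ 2 1 (X 2) = 0" "cJ 2 3 (X 2) = 0"
    "cJ 3 1 (X 3) = 0" "cJ 3 2 (X 3) = 0"
    by (rule vector_cJ_self; simp add: I del: atLeastAtMost_iff One_nat_def)+
  show "X a = cP 1 (X 1) *\<^sub>R Pv B a + l *\<^sub>R dualJ a"
  proof (rule coord_eqI)
    fix n assume "n \<in> {1..d}"
    then show "cP n (X a) = cP n (cP 1 (X 1) *\<^sub>R Pv B a + l *\<^sub>R dualJ a)"
      using a one_two_mem vector_cP_diag[of a 1] vector_cP_off[of a n] three by (cases "a = n") (auto simp: dualJ_def simp del: atLeastAtMost_iff One_nat_def)
  next
    fix m n assume mn: "m \<in> {1..d}" "n \<in> {1..d}"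
    have "cJ m n (X a) = l * cJ m n (dualJ a)"
      using mn[unfolded I] a[unfolded I] 1 l_def[symmetric] self
        cJ_commute[of 2 1 "X a"] cJ_commute[of 3 1 "X a"] cJ_commute[of 3 2 "X a"]
        cJ_commute[of 1 2 "X a"] cJ_commute[of 1 3 "X a"] cJ_commute[of 2 3 "X a"]
      by (elim disjE) (simp_all add: I dualJ_def del: atLeastAtMost_iff One_nat_def)
    then show "cJ m n (X a) = cJ m n (cP 1 (X 1) *\<^sub>R Pv B a + l *\<^sub>R dualJ a)"
      using mn a by (simp del: One_nat_def)
  qed (use a vector_scalar one_two_mem three in \<open>auto simp: dualJ_def simp del: atLeastAtMost_iff One_nat_def\<close>)
qed

text \<open>In the plane the equivariant maps are spanned by the identity and the rotation
  generator, whence the second term.\<close>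

lemma vector_2:
  assumes "d = 2"
  shows "\<exists>k l. \<forall>a\<in>{1..d}. X a = k *\<^sub>R Pv B a + l *\<^sub>R br (Jv B 1 2) (Pv B a)"
proof (intro exI ballI)
  have I: "n \<in> {1..d} \<longleftrightarrow> n = 1 \<or> n = 2" for n
    using assms by auto
  fix a assume a: "a \<in> {1..d}"
  have off: "cP 1 (X 2) = - cP 2 (X 1)" "cP 2 (X 2) = cP 1 (X 1)"
    using vector_rotate[of 1 2] cP_br_J[of 1 2 2 "X 2"] vector_cP_diag[of 1 2] by (simp_all add: I del: atLeastAtMost_iff One_nat_def)
  have self: "cJ 1 2 (X a) = 0" "cJ 2 1 (X a) = 0"
    using a[unfolded I] vector_cJ_self[of 1 2] vector_cJ_self[of 2 1]
      cJ_commute[of 1 2 "X a"] cJ_commute[of 2 1 "X a"] by (auto simp: I simp del: atLeastAtMost_iff One_nat_def)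
  show "X a = cP 1 (X 1) *\<^sub>R Pv B a + (- cP 2 (X 1)) *\<^sub>R br (Jv B 1 2) (Pv B a)"
  proof (rule coord_eqI)
    fix n assume "n \<in> {1..d}"
    then show "cP n (X a) = cP n (cP 1 (X 1) *\<^sub>R Pv B a + (- cP 2 (X 1)) *\<^sub>R br (Jv B 1 2) (Pv B a))"
      using a off by (auto simp: I br_J simp del: atLeastAtMost_iff One_nat_def)
  next
    fix m n assume mn: "m \<in> {1..d}" "n \<in> {1..d}"
    then show "cJ m n (X a) = cJ m n (cP 1 (X 1) *\<^sub>R Pv B a + (- cP 2 (X 1)) *\<^sub>R br (Jv B 1 2) (Pv B a))"
      using a self by (auto simp: I br_J simp del: atLeastAtMost_iff One_nat_def)
  qed (use a vector_scalar one_two_mem in \<open>auto simp: br_J simp del: atLeastAtMost_iff One_nat_def\<close>)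
qed

end

section \<open>Brackets of scalars with \<open>P\<close>, and of \<open>P\<close> with
  \<open>P\<close>\<close>

lemma scalar_br_P:
  assumes K: "\<And>a b. a \<in> {1..d} \<Longrightarrow> b \<in> {1..d} \<Longrightarrow> br (Jv B a b) K = 0"
    and "a \<in> {1..d}" "b \<in> {1..d}" "c \<in> {1..d}"
  shows "br (Jv B a b) (br K (Pv B c)) = kd b c *\<^sub>R br K (Pv B a) - kd a c *\<^sub>R br K (Pv B b)"
  using assms by (simp add: br_derivation[of "Jv B a b" K] br_J)

lemma br_J_PP:
  assumes "a \<in> {1..d}" "b \<in> {1..d}" "c \<in> {1..d}" "e \<in> {1..d}"
  shows "br (Jv B a b) (br (Pv B c) (Pv B e)) =
      kd b c *\<^sub>R br (Pv B a) (Pv B e) - kd a c *\<^sub>R br (Pv B b) (Pv B e)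
      + kd b e *\<^sub>R br (Pv B c) (Pv B a) - kd a e *\<^sub>R br (Pv B c) (Pv B b)"
  using assms by (simp add: br_derivation[of "Jv B a b" "Pv B c"] br_J)

text \<open>The analogue of \<open>vector_rotate\<close> for the two-index family: a bracket is
  obtained from another one through a third index.\<close>

lemma PP_rotate:
  assumes "a \<in> {1..d}" "b \<in> {1..d}" "c \<in> {1..d}" "a \<noteq> b" "a \<noteq> c" "b \<noteq> c"
  shows "br (Pv B c) (Pv B b) = br (Jv B c a) (br (Pv B a) (Pv B b))"
  using assms by (simp add: br_J_PP)

lemma PP_scalar:
  assumes "3 \<le> d" "b \<in> {1..d}" "c \<in> {1..d}"
  shows PP_cH: "cH (br (Pv B c) (Pv B b)) = 0" and PP_cD: "cD (br (Pv B c) (Pv B b)) = 0"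
proof -
  obtain a where a: "a \<in> {1..d}" "a \<noteq> b" "a \<noteq> c"
    using exists_third_index[OF \<open>3 \<le> d\<close>] by metis
  show "cH (br (Pv B c) (Pv B b)) = 0" "cD (br (Pv B c) (Pv B b)) = 0"
    using a assms PP_rotate[of a b c] cH_br_J cD_br_J by (cases "b = c"; simp)+
qed

lemma PP_cP_self:
  assumes "3 \<le> d" "b \<in> {1..d}" "c \<in> {1..d}"
  shows "cP b (br (Pv B c) (Pv B b)) = 0" "cP c (br (Pv B c) (Pv B b)) = 0"
proof -
  have *: "cP b (br (Pv B c) (Pv B b)) = 0" if bc: "b \<in> {1..d}" "c \<in> {1..d}" for b c
  proof -
    obtain a where a: "a \<in> {1..d}" "a \<noteq> b" "a \<noteq> c"
      using exists_third_index[OF \<open>3 \<le> d\<close>] by metis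
    then show ?thesis
      using bc PP_rotate[of a b c] cP_br_J[of c a b] by (cases "b = c") simp_all
  qed
  show "cP b (br (Pv B c) (Pv B b)) = 0" "cP c (br (Pv B c) (Pv B b)) = 0"
    using *[of b c] *[of c b] assms br_commute[of "Pv B c" "Pv B b"] by simp_all
qed

lemma PP_cP_ge_4:
  assumes "4 \<le> d" "b \<in> {1..d}" "c \<in> {1..d}" "n \<in> {1..d}"
  shows "cP n (br (Pv B c) (Pv B b)) = 0"
proof (cases "n = b \<or> n = c \<or> b = c")
  case True
  then show ?thesis using PP_cP_self[of b c] assms by auto
next
  case False
  obtain a where "a \<in> {1..d}" "a \<noteq> b" "a \<noteq> c" "a \<noteq> n"
    using exists_fourth_index[OF \<open>4 \<le> d\<close>] by metis
  then show ?thesis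
    using assms False PP_rotate[of a b c] cP_br_J[of c a n] by auto
qed

lemma PP_cJ_self:
  assumes "3 \<le> d" "b \<in> {1..d}" "c \<in> {1..d}" "n \<in> {1..d}"
  shows "n \<noteq> b \<Longrightarrow> cJ c n (br (Pv B c) (Pv B b)) = 0"
    and "n \<noteq> c \<Longrightarrow> cJ b n (br (Pv B c) (Pv B b)) = 0"
proof -
  have *: "cJ c n (br (Pv B c) (Pv B b)) = 0" if bc: "b \<in> {1..d}" "c \<in> {1..d}" "n \<noteq> b" for b c
    using assms bc PP_rotate[of n b c] cJ_br_J[of c n c n] by (cases "b = c \<or> n = c") auto
  show "n \<noteq> b \<Longrightarrow> cJ c n (br (Pv B c) (Pv B b)) = 0"
    "n \<noteq> c \<Longrightarrow> cJ b n (br (Pv B c) (Pv B b)) = 0"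
    using *[of b c] *[of c b] assms br_commute[of "Pv B c" "Pv B b"] by simp_all
qed

text \<open>The coefficient is symmetric in its two indices, and \<open>PP_rotate\<close> moves one
  index at a time, so any pair can be moved to 1 and 2.\<close>

lemma PP_cJ_diag:
  assumes "3 \<le> d" "b \<in> {1..d}" "c \<in> {1..d}" "b \<noteq> c"
  shows "cJ c b (br (Pv B c) (Pv B b)) = cJ 1 2 (br (Pv B 1) (Pv B 2))"
proof -
  let ?f = "\<lambda>c b. cJ c b (br (Pv B c) (Pv B b))"
  have sym: "?f c b = ?f b c" for b c
    using br_commute[of "Pv B c" "Pv B b"] cJ_commute[of c b "br (Pv B b) (Pv B c)"] by simp
  have move: "?f c b = ?f a b"
    if "a \<in> {1..d}" "b \<in> {1..d}" "c \<in> {1..d}" "a \<noteq> b" "b \<noteq> c" for a b c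
    using that PP_rotate[of a b c] cJ_br_J[of c a c b] by (cases "a = c") auto
  show ?thesis
  proof (cases "b = 2")
    case True
    then show ?thesis using move[of 1 2 c] assms one_two_mem by auto
  next
    case False
    then have "?f c b = ?f 2 b" using move[of 2 b c] assms one_two_mem by auto
    also have "\<dots> = ?f b 2" by (rule sym)
    also have "\<dots> = ?f 1 2" using move[of 1 2 b] assms one_two_mem False by auto
    finally show ?thesis .
  qed
qed

text \<open>Rotations make the coefficient totally antisymmetric in \<open>c\<close>,
  \<open>b\<close>, \<open>m\<close>. The component along \<open>P_n\<close> of the Jacobi identity
  on three \<open>P\<close>s is then three times this coefficient.\<close>

lemma PP_cJ_off:
  assumes "b \<in> {1..d}" "c \<in> {1..d}" "m \<in> {1..d}" "n \<in> {1..d}" "distinct [b, c, m, n]"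
  shows "cJ m n (br (Pv B c) (Pv B b)) = 0"
proof -
  have "card (set [b, c, m, n]) = 4" using assms(5) distinct_card by fastforce
  moreover have "card (set [b, c, m, n]) \<le> card {1..d}" using assms by (intro card_mono) auto
  ultimately have d4: "4 \<le> d" by simp
  define R where "R c b m = cJ m n (br (Pv B c) (Pv B b))" for c b m
  have anti: "R c b m = - R b c m" for c b m
    unfolding R_def using br_commute[of "Pv B c" "Pv B b"] by simp
  have rot: "R c b m = - R m b c"
    if "b \<in> {1..d}" "c \<in> {1..d}" "m \<in> {1..d}" "distinct [b, c, m, n]" for b c m
    unfolding R_def using that assms(4) PP_rotate[of m b c] cJ_br_J[of c m m n] by auto
  \<comment> \<open>The still unknown brackets of \<open>P_k\<close> with \<open>H\<close> and
    \<open>D\<close> enter only through the \<open>H\<close>- and \<open>D\<close>-parts of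
    \<open>x\<close>; those with other \<open>P\<close>s have no \<open>P\<close>-part since
    \<open>d\<close> is at least 4.\<close>
  have cP_P: "cP n (br (Pv B k) x) = - cJ n k x"
    if "k \<in> {1..d}" "cH x = 0" "cD x = 0" for k x
  proof -
    have "cP n (br (Pv B k) x) = - cJ n k x + cH x * cP n (br (Pv B k) (Hv B)) + cD x * cP n (br (Pv B k) (Dv B))"
      by (rule linear_ext_basis)
        (use that assms(4) PP_cP_ge_4[OF d4] in \<open>auto intro!: linearI simp: algebra_simps br_PJ kd_commute
          simp del: atLeastAtMost_iff\<close>)
    then show ?thesis using that by simp
  qed
  have "cP n (br (Pv B m) (br (Pv B c) (Pv B b)) + br (Pv B c) (br (Pv B b) (Pv B m))
      + br (Pv B b) (br (Pv B m) (Pv B c))) = 0"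
    by (simp only: jacobi coord_simps)
  then have "R c b m + R b m c + R m c b = 0"
    using assms d4 cJ_commute[of n m] cJ_commute[of n c] cJ_commute[of n b]
    unfolding R_def by (simp add: cP_P PP_scalar)
  then show ?thesis
    using rot[of b c m] rot[of c b m] anti[of m b c] anti[of m c b] anti[of c b m] assms
    by (auto simp: R_def)
qed

end

section \<open>Normalising the basis\<close>

text \<open>One shape for all \<open>d\<close>, leaving a problem in the plane of \<open>H\<close>
  and \<open>D\<close>: \<open>(h, g)\<close> are the weights of \<open>P\<close>,
  \<open>(v, w)\<close> the bracket of \<open>D\<close> with \<open>H\<close>, and
  \<open>(b, c)\<close> the term that can survive only in dimension 2.\<close>

definition normalised :: "nat \<Rightarrow> ('v::real_vector \<Rightarrow> 'v \<Rightarrow> 'v) \<Rightarrow> (lidx \<Rightarrow> 'v) \<Rightarrow>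
    real \<Rightarrow> real \<Rightarrow> real \<Rightarrow> real \<Rightarrow> real \<Rightarrow> real \<Rightarrow> real \<Rightarrow> bool" where
  "normalised d br B s b c h g v w \<longleftrightarrow>
    (\<forall>a\<in>{1..d}. \<forall>a'\<in>{1..d}. br (Pv B a) (Pv B a') =
       s *\<^sub>R Jv B a a' + eps2 a a' *\<^sub>R (b *\<^sub>R Hv B + c *\<^sub>R Dv B)) \<and>
    (\<forall>a\<in>{1..d}. br (Hv B) (Pv B a) = h *\<^sub>R Pv B a \<and> br (Dv B) (Pv B a) = g *\<^sub>R Pv B a) \<and>
    br (Dv B) (Hv B) = v *\<^sub>R Hv B + w *\<^sub>R Dv B \<and> (d \<noteq> 2 \<longrightarrow> b = 0 \<and> c = 0)"

context lifshitz_algebra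
begin

text \<open>The bracket \<open>Z\<close> is rotation invariant, so besides \<open>H\<close> and
  \<open>D\<close> it can contain only \<open>J_12\<close>, and that only for \<open>d = 2\<close>.
  As \<open>H\<close> and \<open>D\<close> act on \<open>P\<close> by scalars, \<open>Z\<close>
  kills \<open>P_1\<close>, which excludes \<open>J_12\<close>.\<close>

lemma br_DH_eq:
  assumes h: "\<And>a. a \<in> {1..d} \<Longrightarrow> br (Hv B) (Pv B a) = h *\<^sub>R Pv B a"
    and g: "\<And>a. a \<in> {1..d} \<Longrightarrow> br (Dv B) (Pv B a) = g *\<^sub>R Pv B a"
  shows "\<exists>v w. br (Dv B) (Hv B) = v *\<^sub>R Hv B + w *\<^sub>R Dv B"
proof -
  define Z where "Z = br (Dv B) (Hv B)"
  have J0: "br (Jv B a b) Z = 0" if "a \<in> {1..d}" "b \<in> {1..d}" for a b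
    unfolding Z_def using that by (simp add: br_derivation[of "Jv B a b"] br_J)
  have P0: "cP n Z = 0" if n: "n \<in> {1..d}" for n
  proof -
    obtain a where a: "a \<in> {1..d}" "a \<noteq> n"
      using that[of "if n = 1 then 2 else 1"] one_two_mem by (auto split: if_splits)
    show ?thesis
      using cP_br_J[OF a(1) n a(1), of Z] a J0[OF a(1) n] by simp
  qed
  have Joff: "cJ m n Z = 0" if "3 \<le> d" and mn: "m \<in> {1..d}" "n \<in> {1..d}" for m n
  proof (cases "m = n")
    case False
    obtain a where a: "a \<in> {1..d}" "a \<noteq> m" "a \<noteq> n"
      using exists_third_index[OF \<open>3 \<le> d\<close>] by metis
    show ?thesis
      using cJ_br_J[OF a(1) mn(1) a(1) mn(2), of Z] a J0[OF a(1) mn(1)] False by simp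
  qed simp
  define j where "j = cJ 1 2 Z"
  have "cJ m n Z = cJ m n (j *\<^sub>R Jv B 1 2)" if mn: "m \<in> {1..d}" "n \<in> {1..d}" for m n
  proof (cases "3 \<le> d")
    case True
    then show ?thesis using Joff mn one_two_mem by (simp add: j_def)
  next
    case False
    then have "(m = 1 \<or> m = 2) \<and> (n = 1 \<or> n = 2)" using mn by auto
    then show ?thesis
      using cJ_commute[of 2 1 Z] one_two_mem by (auto simp: j_def simp del: One_nat_def atLeastAtMost_iff)
  qed
  then have Z: "Z = j *\<^sub>R Jv B 1 2 + cH Z *\<^sub>R Hv B + cD Z *\<^sub>R Dv B"
    using one_two_mem P0 by (intro coord_eqI) (simp_all del: One_nat_def atLeastAtMost_iff)
  have "br (Dv B) (br (Hv B) (Pv B 1)) = br Z (Pv B 1) + br (Hv B) (br (Dv B) (Pv B 1))"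
    unfolding Z_def by (rule br_derivation)
  then have "br Z (Pv B 1) = 0"
    using one_two_mem by (simp add: h g mult.commute del: One_nat_def atLeastAtMost_iff)
  then have "cP 2 (br (j *\<^sub>R Jv B 1 2 + cH Z *\<^sub>R Hv B + cD Z *\<^sub>R Dv B) (Pv B 1)) = 0"
    unfolding Z[symmetric] by simp
  then have "j = 0"
    using one_two_mem by (simp add: h g br_J del: One_nat_def atLeastAtMost_iff)
  then show ?thesis
    using Z unfolding Z_def by auto
qed

lemma normalised_ge_4:
  assumes d4: "4 \<le> d"
  shows "\<exists>s h g v w. normalised d br B s 0 0 h g v w"
proof -
  obtain h where h: "\<forall>a\<in>{1..d}. br (Hv B) (Pv B a) = h *\<^sub>R Pv B a"
    using vector_ge_4[of "\<lambda>a. br (Hv B) (Pv B a)", OF scalar_br_P[OF br_JH] d4] by blast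
  obtain g where g: "\<forall>a\<in>{1..d}. br (Dv B) (Pv B a) = g *\<^sub>R Pv B a"
    using vector_ge_4[of "\<lambda>a. br (Dv B) (Pv B a)", OF scalar_br_P[OF br_JD] d4] by blast
  obtain v w where vw: "br (Dv B) (Hv B) = v *\<^sub>R Hv B + w *\<^sub>R Dv B"
    using br_DH_eq h g by metis
  define s where "s = cJ 1 2 (br (Pv B 1) (Pv B 2))"
  have "br (Pv B c) (Pv B b) = s *\<^sub>R Jv B c b" if cb: "c \<in> {1..d}" "b \<in> {1..d}" for c b
  proof (cases "c = b")
    case False
    let ?Y = "br (Pv B c) (Pv B b)"
    have d3: "3 \<le> d" using d4 by simp
    show ?thesis
    proof (rule coord_eqI)
      fix m n assume mn: "m \<in> {1..d}" "n \<in> {1..d}"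
      have diag: "cJ c b ?Y = s" "cJ b c ?Y = - s"
        using PP_cJ_diag[OF d3 cb(2) cb(1)] False cJ_commute[of b c ?Y] by (simp_all add: s_def)
      \<comment> \<open>Entries meeting \<open>b\<close> or \<open>c\<close> are settled by
        rotations; only four distinct indices need the Jacobi identity.\<close>
      consider "m = n" | "m = c" "n = b" | "m = b" "n = c" | "m = c" "n \<noteq> b" "n \<noteq> c" | "m = b" "n \<noteq> b" "n \<noteq> c"
        | "n = c" "m \<noteq> b" "m \<noteq> c" | "n = b" "m \<noteq> b" "m \<noteq> c" | "distinct [b, c, m, n]"
        using False by fastforce
      then show "cJ m n ?Y = cJ m n (s *\<^sub>R Jv B c b)"
      proof cases
        case 8
        then show ?thesis using PP_cJ_off[OF cb(2) cb(1) mn] cb mn by simp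
      qed (use mn cb False diag PP_cJ_self[OF d3 cb(2) cb(1) mn(1)] PP_cJ_self[OF d3 cb(2) cb(1) mn(2)]
            cJ_commute[of m n ?Y] in \<open>simp_all del: atLeastAtMost_iff\<close>)
    qed (use cb d3 d4 PP_scalar PP_cP_ge_4 in \<open>simp_all del: atLeastAtMost_iff\<close>)
  qed simp
  then have "normalised d br B s 0 0 h g v w"
    using h g vw by (auto simp: normalised_def)
  then show ?thesis by blast
qed

lemma normalised_3:
  assumes d3: "d = 3"
    and PP: "\<And>a b. a \<in> {1..d} \<Longrightarrow> b \<in> {1..d} \<Longrightarrow> br (Pv B a) (Pv B b) = s *\<^sub>R Jv B a b"
  shows "\<exists>h g v w. normalised d br B s 0 0 h g v w"
proof -
  have mem: "1 \<in> {1..d}" "2 \<in> {1..d}" "3 \<in> {1..d}" using d3 by auto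
  have *: "\<exists>k. \<forall>a\<in>{1..d}. br K (Pv B a) = k *\<^sub>R Pv B a"
    if K: "\<And>a b. a \<in> {1..d} \<Longrightarrow> b \<in> {1..d} \<Longrightarrow> br (Jv B a b) K = 0" for K
  proof -
    obtain k l where kl: "\<forall>a\<in>{1..d}. br K (Pv B a) = k *\<^sub>R Pv B a + l *\<^sub>R dualJ a"
      using vector_3[of "\<lambda>a. br K (Pv B a)", OF scalar_br_P[OF K] d3] by blast
    \<comment> \<open>The derivation given by \<open>K\<close> is applied to \<open>PP\<close> for
      the indices 1 and 2; the coefficient of \<open>P_3\<close> shows that \<open>l\<close>
      vanishes.\<close>
    have "br K (Jv B 1 2) = 0" using K[OF mem(1,2)] br_commute[of K "Jv B 1 2"] by simp
    then have "0 = br K (br (Pv B 1) (Pv B 2))" by (simp only: PP[OF mem(1,2)]) simp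
    also have "\<dots> = br (br K (Pv B 1)) (Pv B 2) + br (Pv B 1) (br K (Pv B 2))"
      by (rule br_derivation)
    also have "\<dots> = (2 * k * s) *\<^sub>R Jv B 1 2 - (2 * l) *\<^sub>R Pv B 3"
      using mem bspec[OF kl mem(1)] bspec[OF kl mem(2)]
      by (simp add: dualJ_def PP br_J br_PJ del: One_nat_def atLeastAtMost_iff)
        (simp add: algebra_simps flip: scaleR_add_left)
    finally have "cP 3 0 = cP 3 ((2 * k * s) *\<^sub>R Jv B 1 2 - (2 * l) *\<^sub>R Pv B 3)"
      by (rule arg_cong)
    then have "l = 0" using mem by (simp del: One_nat_def atLeastAtMost_iff)
    then show ?thesis using kl by auto
  qed
  obtain h where h: "\<forall>a\<in>{1..d}. br (Hv B) (Pv B a) = h *\<^sub>R Pv B a"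
    using *[OF br_JH] by blast
  obtain g where g: "\<forall>a\<in>{1..d}. br (Dv B) (Pv B a) = g *\<^sub>R Pv B a"
    using *[OF br_JD] by blast
  obtain v w where vw: "br (Dv B) (Hv B) = v *\<^sub>R Hv B + w *\<^sub>R Dv B"
    using br_DH_eq h g by metis
  have "normalised d br B s 0 0 h g v w"
    using h g vw PP by (auto simp: normalised_def)
  then show ?thesis by blast
qed

lemma PP_3:
  assumes d3: "d = 3"
  obtains s t where "br (Pv B 1) (Pv B 2) = s *\<^sub>R Jv B 1 2 + t *\<^sub>R Pv B 3"
    "br (Pv B 2) (Pv B 3) = s *\<^sub>R Jv B 2 3 + t *\<^sub>R Pv B 1"
    "br (Pv B 3) (Pv B 1) = s *\<^sub>R Jv B 3 1 + t *\<^sub>R Pv B 2"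
proof -
  have I: "n \<in> {1..d} \<longleftrightarrow> n = 1 \<or> n = 2 \<or> n = 3" for n
    using d3 by auto
  have d3': "3 \<le> d" using d3 by simp
  define Y where "Y c b = br (Pv B c) (Pv B b)" for c b
  define s where "s = cJ 1 2 (Y 1 2)"
  define t where "t = cP 3 (Y 1 2)"
  have anti: "Y c b = - Y b c" for c b
    unfolding Y_def by (rule br_commute)
  have tP: "cP a (Y c b) = cP c (Y b a)"
    if "a \<in> {1..d}" "b \<in> {1..d}" "c \<in> {1..d}" "a \<noteq> b" "a \<noteq> c" "b \<noteq> c" for a b c
    using PP_rotate[OF that] cP_br_J[of c a a "Y a b"] that anti[of a b] by (simp add: Y_def)
  have t': "cP 1 (Y 2 3) = t" "cP 2 (Y 3 1) = t"
    using tP[of 3 2 1] tP[of 1 3 2] by (simp_all add: I t_def del: One_nat_def atLeastAtMost_iff)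
  have eq: "Y c b = s *\<^sub>R Jv B c b + t *\<^sub>R Pv B a"
    if abc: "a \<in> {1..d}" "b \<in> {1..d}" "c \<in> {1..d}" "a \<noteq> b" "a \<noteq> c" "b \<noteq> c" "cP a (Y c b) = t" for a b c
  proof (rule coord_eqI)
    have all: "n = a \<or> n = b \<or> n = c" if "n \<in> {1..d}" for n
      using that abc by (auto simp: I simp del: One_nat_def atLeastAtMost_iff)
    show "cP n (Y c b) = cP n (s *\<^sub>R Jv B c b + t *\<^sub>R Pv B a)" if "n \<in> {1..d}" for n
      using all[OF that] abc PP_cP_self[OF d3' abc(2,3)]
      by (auto simp: Y_def simp del: One_nat_def atLeastAtMost_iff)
    show "cJ m n (Y c b) = cJ m n (s *\<^sub>R Jv B c b + t *\<^sub>R Pv B a)" if "m \<in> {1..d}" "n \<in> {1..d}" for m n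
      using all[OF that(1)] all[OF that(2)] abc PP_cJ_diag[OF d3' abc(2,3)] PP_cJ_self[OF d3' abc(2,3,1)]
        cJ_commute[of b c "Y c b"] cJ_commute[of a c "Y c b"] cJ_commute[of a b "Y c b"]
      by (auto simp: Y_def s_def simp del: One_nat_def atLeastAtMost_iff)
  qed (use abc PP_scalar[OF d3'] in \<open>simp_all add: Y_def del: One_nat_def atLeastAtMost_iff\<close>)
  show ?thesis
    by (rule that[of s t]; fold Y_def; rule eq) (simp_all add: I t' t_def[symmetric] del: One_nat_def atLeastAtMost_iff)
qed

text \<open>In dimension 3 the family \<open>dualJ\<close> satisfies the same rotation law as
  \<open>P\<close>, so adding a multiple of it preserves the common brackets.\<close>

lemma lifshitz_shift_P:
  fixes t :: real
  assumes d3: "d = 3"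
  defines "B' \<equiv> (\<lambda>i. case i of LP a \<Rightarrow> Pv B a + t *\<^sub>R dualJ a | _ \<Rightarrow> B i)"
  shows "lifshitz_algebra d B' br"
proof -
  have I: "n \<in> {1..d} \<longleftrightarrow> n = 1 \<or> n = 2 \<or> n = 3" for n
    using d3 by auto
  have J: "Jv B' a b = Jv B a b" for a b
    by (simp add: Jv_def B'_def)
  have P: "Pv B' a = Pv B a + t *\<^sub>R dualJ a" for a by (simp add: B'_def)
  have HD: "Hv B' = Hv B" "Dv B' = Dv B" by (simp_all add: B'_def)
  have "is_basis d B'"
  proof (rule is_basis_if_spans[OF basis])
    fix i assume i: "i \<in> Idx d"
    have 1: "B' j \<in> span (B' ` Idx d)" if "j \<in> Idx d" for j
      using that by (intro span_base) auto
    have 2: "Jv B' a b \<in> span (B' ` Idx d)" if "a \<in> {1..d}" "b \<in> {1..d}" for a b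
      unfolding Jv_def using that by (auto intro!: 1 Idx_mem span_neg span_zero)
    have "dualJ a \<in> span (B' ` Idx d)" for a
      using 2 I by (auto simp: J dualJ_def)
    then have "Pv B' a - t *\<^sub>R dualJ a \<in> span (B' ` Idx d)" if "a \<in> {1..d}" for a
      using 1[OF Idx_mem(2)[OF that]] by (intro span_diff span_scale)
    then have "Pv B a \<in> span (B' ` Idx d)" if "a \<in> {1..d}" for a
      using that by (simp add: P)
    moreover have "B i \<in> span (B' ` Idx d)" if "B i = B' i"
      using 1[OF i] that by simp
    ultimately show "B i \<in> span (B' ` Idx d)"
      using i by (cases i) (auto simp: B'_def Idx_def)
  qed
  moreover have T: "br (Jv B a b) (dualJ c) = kd b c *\<^sub>R dualJ a - kd a c *\<^sub>R dualJ b"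
    if "a \<in> {1..d}" "b \<in> {1..d}" "c \<in> {1..d}" for a b c
    using that[unfolded I] Jv_commute[of B 2 1] Jv_commute[of B 3 2] Jv_commute[of B 1 3]
    by (elim disjE) (simp_all add: I br_JJ dualJ_def del: One_nat_def atLeastAtMost_iff)
  have "br (Jv B a b) (Pv B c + t *\<^sub>R dualJ c) =
      kd b c *\<^sub>R (Pv B a + t *\<^sub>R dualJ a) - kd a c *\<^sub>R (Pv B b + t *\<^sub>R dualJ b)"
    if "a \<in> {1..d}" "b \<in> {1..d}" "c \<in> {1..d}" for a b c
    using that by (simp add: br_JP T del: One_nat_def atLeastAtMost_iff) (simp add: algebra_simps)
  then have "common_brackets d br B'"
    unfolding common_brackets_def J P HD by (intro conjI ballI) (simp_all only: br_J)
  ultimately show ?thesis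
    using d_ge_2 lie by unfold_locales
qed

lemma normalise_3:
  assumes d3: "d = 3"
  shows "\<exists>B' s h g v w. lifshitz_algebra d B' br \<and> normalised d br B' s 0 0 h g v w"
proof -
  have I: "n \<in> {1..d} \<longleftrightarrow> n = 1 \<or> n = 2 \<or> n = 3" for n
    using d3 by auto
  obtain s t where st: "br (Pv B 1) (Pv B 2) = s *\<^sub>R Jv B 1 2 + t *\<^sub>R Pv B 3"
    "br (Pv B 2) (Pv B 3) = s *\<^sub>R Jv B 2 3 + t *\<^sub>R Pv B 1"
    "br (Pv B 3) (Pv B 1) = s *\<^sub>R Jv B 3 1 + t *\<^sub>R Pv B 2"
    using PP_3[OF d3] by metis
  \<comment> \<open>Each of the two cross terms in a shifted bracket contributes
    \<open>-t / 2\<close> times the third \<open>P\<close>, so together they cancel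
    \<open>t\<close>. The quadratic term lowers \<open>s\<close> by
    \<open>(t / 2)\<^sup>2\<close>.\<close>
  define B' where "B' = (\<lambda>i. case i of LP a \<Rightarrow> Pv B a + (t / 2) *\<^sub>R dualJ a | _ \<Rightarrow> B i)"
  interpret B': lifshitz_algebra d B' br
    unfolding B'_def by (rule lifshitz_shift_P[OF d3])
  have J: "Jv B' a b = Jv B a b" for a b
    by (simp add: Jv_def B'_def)
  have P: "Pv B' a = Pv B a + (t / 2) *\<^sub>R dualJ a" for a by (simp add: B'_def)
  define s' where "s' = s - (t / 2)\<^sup>2"
  have half: "(t / 2) *\<^sub>R x + (t / 2) *\<^sub>R x = t *\<^sub>R x" for x :: 'v
    by (simp flip: scaleR_add_left)
  have 1: "br (Pv B' 1) (Pv B' 2) = s' *\<^sub>R Jv B' 1 2"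
    unfolding P J using Jv_commute[of B 2 1] half[of "Pv B 3"]
    by (simp add: st br_J br_PJ I s'_def dualJ_def power2_eq_square algebra_simps del: One_nat_def atLeastAtMost_iff)
  have 2: "br (Pv B' 2) (Pv B' 3) = s' *\<^sub>R Jv B' 2 3"
    unfolding P J using Jv_commute[of B 3 2] half[of "Pv B 1"]
    by (simp add: st br_J br_PJ I s'_def dualJ_def power2_eq_square algebra_simps del: One_nat_def atLeastAtMost_iff)
  have 3: "br (Pv B' 3) (Pv B' 1) = s' *\<^sub>R Jv B' 3 1"
    unfolding P J using Jv_commute[of B 1 3] half[of "Pv B 2"]
    by (simp add: st br_J br_PJ I s'_def dualJ_def power2_eq_square algebra_simps del: One_nat_def atLeastAtMost_iff)
  have 4: "br (Pv B' a) (Pv B' b) = s' *\<^sub>R Jv B' a b" if "br (Pv B' b) (Pv B' a) = s' *\<^sub>R Jv B' b a" for a b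
    using that br_commute[of "Pv B' a" "Pv B' b"] Jv_commute[of B' a b] by simp
  have "br (Pv B' a) (Pv B' b) = s' *\<^sub>R Jv B' a b" if "a \<in> {1..d}" "b \<in> {1..d}" for a b
    using that[unfolded I] 1 2 3 4[OF 1] 4[OF 2] 4[OF 3] by (elim disjE) simp_all
  then show ?thesis
    using B'.normalised_3[OF d3] B'.lifshitz_algebra_axioms by blast
qed

lemma normalise_2:
  assumes d2: "d = 2"
  shows "\<exists>B' s b c h g v w. lifshitz_algebra d B' br \<and> normalised d br B' s b c h g v w"
proof -
  have I: "n \<in> {1..d} \<longleftrightarrow> n = 1 \<or> n = 2" for n
    using d2 by auto
  obtain h l where hl: "\<forall>a\<in>{1..d}. br (Hv B) (Pv B a) = h *\<^sub>R Pv B a + l *\<^sub>R br (Jv B 1 2) (Pv B a)"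
    using vector_2[of "\<lambda>a. br (Hv B) (Pv B a)", OF scalar_br_P[OF br_JH] d2] by blast
  obtain g k where gk: "\<forall>a\<in>{1..d}. br (Dv B) (Pv B a) = g *\<^sub>R Pv B a + k *\<^sub>R br (Jv B 1 2) (Pv B a)"
    using vector_2[of "\<lambda>a. br (Dv B) (Pv B a)", OF scalar_br_P[OF br_JD] d2] by blast
  \<comment> \<open>The rotation parts of \<open>H\<close> and \<open>D\<close> on \<open>P\<close>
    are subtracted. For \<open>d = 2\<close> this keeps them scalars, because \<open>J_12\<close>
    commutes with itself.\<close>
  define B' where "B' = (\<lambda>i. case i of LH \<Rightarrow> Hv B - l *\<^sub>R Jv B 1 2 | LD \<Rightarrow> Dv B - k *\<^sub>R Jv B 1 2 | _ \<Rightarrow> B i)"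
  have J: "Jv B' a b = Jv B a b" for a b
    by (simp add: Jv_def B'_def)
  have P: "Pv B' a = Pv B a" for a by (simp add: B'_def)
  have HD: "Hv B' = Hv B - l *\<^sub>R Jv B 1 2" "Dv B' = Dv B - k *\<^sub>R Jv B 1 2" by (simp_all add: B'_def)
  have "is_basis d B'"
  proof (rule is_basis_if_spans[OF basis])
    fix i assume i: "i \<in> Idx d"
    have 1: "B' j \<in> span (B' ` Idx d)" if "j \<in> Idx d" for j
      using that by (intro span_base) auto
    have 2: "Jv B 1 2 \<in> span (B' ` Idx d)"
      using 1[OF Idx_mem(1)[of 1 2]] one_two_mem by (simp add: J[symmetric]) (simp add: Jv_def)
    have "Hv B' + l *\<^sub>R Jv B 1 2 \<in> span (B' ` Idx d)" "Dv B' + k *\<^sub>R Jv B 1 2 \<in> span (B' ` Idx d)"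
      using 1 2 by (intro span_add span_scale; simp add: Idx_mem)+
    then have "Hv B \<in> span (B' ` Idx d)" "Dv B \<in> span (B' ` Idx d)"
      by (simp_all add: HD)
    moreover have "B i \<in> span (B' ` Idx d)" if "B i = B' i"
      using 1[OF i] that by simp
    ultimately show "B i \<in> span (B' ` Idx d)"
      by (cases i) (auto simp: B'_def)
  qed
  moreover have "br (Jv B a b) (Jv B 1 2) = 0" if "a \<in> {1..d}" "b \<in> {1..d}" for a b
    using that[unfolded I] Jv_commute[of B 2 1] by (elim disjE) simp_all
  then have "common_brackets d br B'"
    unfolding common_brackets_def J P HD using br_J by simp
  ultimately interpret B': lifshitz_algebra d B' br
    using d_ge_2 lie by unfold_locales
  have hg: "br (Hv B') (Pv B' a) = h *\<^sub>R Pv B' a" "br (Dv B') (Pv B' a) = g *\<^sub>R Pv B' a"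
    if "a \<in> {1..d}" for a
    using bspec[OF hl that] bspec[OF gk that] by (simp_all add: HD P)
  then obtain v w where vw: "br (Dv B') (Hv B') = v *\<^sub>R Hv B' + w *\<^sub>R Dv B'"
    using B'.br_DH_eq by metis
  define Y where "Y = br (Pv B' 1) (Pv B' 2)"
  have J0: "br (Jv B' 1 2) Y = 0"
    unfolding Y_def by (subst B'.br_J_PP) (simp_all add: I del: One_nat_def atLeastAtMost_iff)
  have P0: "B'.cP 1 Y = 0" "B'.cP 2 Y = 0"
    using B'.cP_br_J[of 1 2 2 Y] B'.cP_br_J[of 1 2 1 Y] J0 by (simp_all add: I del: One_nat_def atLeastAtMost_iff)
  define s where "s = B'.cJ 1 2 Y"
  define b where "b = B'.cH Y"
  define c where "c = B'.cD Y"
  have Y: "Y = s *\<^sub>R Jv B' 1 2 + (b *\<^sub>R Hv B' + c *\<^sub>R Dv B')"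
  proof (rule B'.coord_eqI)
    show "B'.cJ m n Y = B'.cJ m n (s *\<^sub>R Jv B' 1 2 + (b *\<^sub>R Hv B' + c *\<^sub>R Dv B'))"
      if "m \<in> {1..d}" "n \<in> {1..d}" for m n
      using that[unfolded I] B'.cJ_commute[of 2 1 Y]
      by (elim disjE) (simp_all add: I s_def del: One_nat_def atLeastAtMost_iff)
    show "B'.cP n Y = B'.cP n (s *\<^sub>R Jv B' 1 2 + (b *\<^sub>R Hv B' + c *\<^sub>R Dv B'))"
      if "n \<in> {1..d}" for n
      using that[unfolded I] P0
      by (elim disjE) (simp_all add: I del: One_nat_def atLeastAtMost_iff)
  qed (simp_all add: I b_def c_def del: One_nat_def atLeastAtMost_iff)
  have Y': "br (Pv B' 2) (Pv B' 1) = s *\<^sub>R Jv B' 2 1 - (b *\<^sub>R Hv B' + c *\<^sub>R Dv B')"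
    using br_commute[of "Pv B' 2" "Pv B' 1"] Jv_commute[of B' 2 1] Y by (simp add: Y_def)
  have "br (Pv B' a) (Pv B' a') = s *\<^sub>R Jv B' a a' + eps2 a a' *\<^sub>R (b *\<^sub>R Hv B' + c *\<^sub>R Dv B')"
    if "a \<in> {1..d}" "a' \<in> {1..d}" for a a'
    using that[unfolded I] Y Y' by (elim disjE) (simp_all add: Y_def eps2_def del: One_nat_def)
  then have "normalised d br B' s b c h g v w"
    using hg vw d2 by (simp add: normalised_def)
  then show ?thesis using B'.lifshitz_algebra_axioms by blast
qed

lemma normalise: "\<exists>B' s b c h g v w. lifshitz_algebra d B' br \<and> normalised d br B' s b c h g v w"
proof -
  consider "d = 2" | "d = 3" | "4 \<le> d" using d_ge_2 by linarith
  then show ?thesis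
    using normalise_2 normalise_3 normalised_ge_4 lifshitz_algebra_axioms by cases blast+
qed

end

section \<open>Reduction to the list\<close>

text \<open>Only \<open>J_12\<close> is shifted by \<open>u\<close>. This absorbs the
  \<open>H\<close>- and \<open>D\<close>-parts of the bracket of \<open>P_1\<close> with
  \<open>P_2\<close> when its \<open>J\<close>-part is nonzero.\<close>

definition change_basis :: "(lidx \<Rightarrow> 'v::real_vector) \<Rightarrow> 'v \<Rightarrow> real \<Rightarrow> 'v \<Rightarrow> 'v \<Rightarrow> lidx \<Rightarrow> 'v" where
  "change_basis B u r H D i = (case i of
     LJ a b \<Rightarrow> B (LJ a b) + eps2 a b *\<^sub>R u | LP a \<Rightarrow> r *\<^sub>R B (LP a) | LH \<Rightarrow> H | LD \<Rightarrow> D)"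

context lifshitz_algebra
begin

text \<open>The equations \<open>PH\<close>, \<open>DP\<close>, \<open>DH\<close> and
  \<open>PP\<close> compare coefficients in the new basis; the determinant in \<open>DH\<close>
  appears because the bracket of two vectors in the plane of \<open>H\<close> and \<open>D\<close>
  scales by it. A nonzero shift must be central, which is what \<open>u\<close> ensures.\<close>

lemma realises_change_basis:
  fixes x1 x2 y1 y2 u1 u2 r :: real
  defines "B' \<equiv> change_basis B (u1 *\<^sub>R Hv B + u2 *\<^sub>R Dv B) r
    (x1 *\<^sub>R Hv B + x2 *\<^sub>R Dv B) (y1 *\<^sub>R Hv B + y2 *\<^sub>R Dv B)"
  assumes norm: "normalised d br B s b c h g v w"
    and r: "r \<noteq> 0" and det: "x1 * y2 - x2 * y1 \<noteq> 0"
    and u: "u1 = 0 \<and> u2 = 0 \<or> d = 2 \<and> u1 * h + u2 * g = 0 \<and> v = 0 \<and> w = 0"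
    and PH: "x1 * h + x2 * g = 0" and DP: "y1 * h + y2 * g = dp L"
    and DH: "(x1 * y2 - x2 * y1) * v = dh L * x1" "(x1 * y2 - x2 * y1) * w = dh L * x2"
    and PP: "r\<^sup>2 * s = pJ L" "r\<^sup>2 * b = pJ L * u1 + pH L * x1" "r\<^sup>2 * c = pJ L * u2 + pH L * x2"
  shows "realises d L br B'"
proof -
  define U where "U = u1 *\<^sub>R Hv B + u2 *\<^sub>R Dv B"
  have J: "Jv B' a a' = Jv B a a' + eps2 a a' *\<^sub>R U" for a a'
    by (auto simp: Jv_def B'_def change_basis_def eps2_def U_def)
  have P: "Pv B' a = r *\<^sub>R Pv B a" for a by (simp add: B'_def change_basis_def)
  have H: "Hv B' = x1 *\<^sub>R Hv B + x2 *\<^sub>R Dv B" and D: "Dv B' = y1 *\<^sub>R Hv B + y2 *\<^sub>R Dv B"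
    by (simp_all add: B'_def change_basis_def)
  define e where "e = x1 * y2 - x2 * y1"
  have nPP: "br (Pv B a) (Pv B a') = s *\<^sub>R Jv B a a' + eps2 a a' *\<^sub>R (b *\<^sub>R Hv B + c *\<^sub>R Dv B)"
    if "a \<in> {1..d}" "a' \<in> {1..d}" for a a'
    using norm that by (simp add: normalised_def)
  have nHP: "br (Hv B) (Pv B a) = h *\<^sub>R Pv B a" "br (Dv B) (Pv B a) = g *\<^sub>R Pv B a"
    if "a \<in> {1..d}" for a
    using norm that by (simp_all add: normalised_def)
  have nDH: "br (Dv B) (Hv B) = v *\<^sub>R Hv B + w *\<^sub>R Dv B"
    using norm by (simp add: normalised_def)
  have nHD: "br (Hv B) (Dv B) = - (v *\<^sub>R Hv B + w *\<^sub>R Dv B)"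
    using br_commute[of "Hv B" "Dv B"] nDH by simp
  have "is_basis d B'"
  proof (rule is_basis_if_spans[OF basis])
    let ?S = "span (B' ` Idx d)"
    have mem: "B' j \<in> ?S" if "j \<in> Idx d" for j
      using that by (intro span_base) auto
    have e1: "(y2 * x1) / e - (x2 * y1) / e = 1"
      using det unfolding e_def diff_divide_distrib[symmetric] by (simp add: mult.commute)
    \<comment> \<open>Cramer's rule with determinant \<open>e\<close>.\<close>
    have "Hv B = (y2 / e) *\<^sub>R Hv B' - (x2 / e) *\<^sub>R Dv B'"
      "Dv B = (x1 / e) *\<^sub>R Dv B' - (y1 / e) *\<^sub>R Hv B'"
      by (rule coord_eqI; use e1 in \<open>simp add: H D mult.commute\<close>)+
    moreover have "Hv B' \<in> ?S" "Dv B' \<in> ?S" using mem Idx_mem by auto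
    ultimately have HD: "Hv B \<in> ?S" "Dv B \<in> ?S"
      by (metis span_diff span_scale)+
    then have "U \<in> ?S"
      unfolding U_def by (intro span_add span_scale)
    then have "B (LJ a a') \<in> ?S" if "LJ a a' \<in> Idx d" for a a'
      using span_diff[OF mem[OF that] span_scale[of U "B' ` Idx d" "eps2 a a'"]]
      by (simp add: B'_def change_basis_def U_def)
    moreover have "Pv B a \<in> ?S" if "LP a \<in> Idx d" for a
      using span_scale[OF mem[OF that], of "inverse r"] r by (simp add: P)
    ultimately show "B i \<in> ?S" if "i \<in> Idx d" for i
      using that HD by (cases i) auto
  qed
  have UP: "br U (Pv B a) = 0" if "a \<in> {1..d}" for a
    using u nHP[OF that] by (auto simp: U_def simp flip: scaleR_add_left)
  have UH: "br U (Hv B) = 0" "br U (Dv B) = 0"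
    using u by (auto simp: U_def nDH nHD)
  have JU: "br (Jv B a a') U = 0" if "a \<in> {1..d}" "a' \<in> {1..d}" for a a'
    using that by (simp add: U_def br_J)
  then have UJ: "br U (Jv B a a') = 0" if "a \<in> {1..d}" "a' \<in> {1..d}" for a a'
    using br_commute[of U "Jv B a a'"] that by simp
  have "common_brackets d br B'"
    unfolding common_brackets_def
  proof (intro conjI ballI)
    fix i j k l assume ijkl: "i \<in> {1..d}" "j \<in> {1..d}" "k \<in> {1..d}" "l \<in> {1..d}"
    \<comment> \<open>A nonzero shift forces \<open>d = 2\<close>, where the shifts on the right of
      the \<open>J\<close> relations cancel.\<close>
    have "kd j k *\<^sub>R eps2 i l *\<^sub>R U - kd i k *\<^sub>R eps2 j l *\<^sub>R U - kd j l *\<^sub>R eps2 i k *\<^sub>R U + kd i l *\<^sub>R eps2 j k *\<^sub>R U = 0"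
    proof (cases "U = 0")
      case False
      then have "d = 2" using u by (auto simp: U_def)
      then have "(i = 1 \<or> i = 2) \<and> (j = 1 \<or> j = 2) \<and> (k = 1 \<or> k = 2) \<and> (l = 1 \<or> l = 2)"
        using ijkl by auto
      then show ?thesis by (elim conjE disjE) (simp_all add: eps2_def)
    qed simp
    moreover have "br (Jv B' i j) (Jv B' k l) = br (Jv B i j) (Jv B k l)"
      using ijkl by (simp add: J JU UJ)
    ultimately show "br (Jv B' i j) (Jv B' k l) = kd j k *\<^sub>R Jv B' i l - kd i k *\<^sub>R Jv B' j l
        - kd j l *\<^sub>R Jv B' i k + kd i l *\<^sub>R Jv B' j k"
      using ijkl by (simp add: br_JJ J scaleR_add_right algebra_simps)
  next
    fix i j k assume ijk: "i \<in> {1..d}" "j \<in> {1..d}" "k \<in> {1..d}"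
    then show "br (Jv B' i j) (Pv B' k) = kd j k *\<^sub>R Pv B' i - kd i k *\<^sub>R Pv B' j"
      by (simp add: J P UP br_J algebra_simps)
  next
    fix i j assume ij: "i \<in> {1..d}" "j \<in> {1..d}"
    then show "br (Jv B' i j) (Hv B') = 0" "br (Jv B' i j) (Dv B') = 0"
      by (simp_all add: J H D UH br_J)
  qed
  moreover have "br (Pv B' a) (Pv B' a') = pp L B' a a'" if "a \<in> {1..d}" "a' \<in> {1..d}" for a a'
  proof -
    have "br (Pv B' a) (Pv B' a') = (r\<^sup>2 * s) *\<^sub>R Jv B a a'
        + eps2 a a' *\<^sub>R ((r\<^sup>2 * b) *\<^sub>R Hv B + (r\<^sup>2 * c) *\<^sub>R Dv B)"
      using that by (simp add: P nPP power2_eq_square algebra_simps)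
    also have "\<dots> = pp L B' a a'"
      unfolding PP pp_eq J H U_def by (simp add: algebra_simps)
    finally show ?thesis .
  qed
  moreover have "br (Pv B' a) (Hv B') = 0" "br (Dv B') (Pv B' a) = dp L *\<^sub>R Pv B' a"
    if a: "a \<in> {1..d}" for a
  proof -
    have "br (Hv B') (Pv B' a) = (r * (x1 * h + x2 * g)) *\<^sub>R Pv B a"
      using a by (simp add: H P nHP algebra_simps)
    then show "br (Pv B' a) (Hv B') = 0"
      using PH br_commute[of "Pv B' a" "Hv B'"] by simp
    have "br (Dv B') (Pv B' a) = (r * (y1 * h + y2 * g)) *\<^sub>R Pv B a"
      using a by (simp add: D P nHP algebra_simps)
    then show "br (Dv B') (Pv B' a) = dp L *\<^sub>R Pv B' a"
      unfolding DP by (simp add: P mult.commute)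
  qed
  moreover have "br (Dv B') (Hv B') = dh L *\<^sub>R Hv B'"
  proof -
    have "br (Dv B') (Hv B') = (e * v) *\<^sub>R Hv B + (e * w) *\<^sub>R Dv B"
      by (simp add: H D nDH nHD e_def algebra_simps)
    also have "\<dots> = dh L *\<^sub>R Hv B'"
      unfolding DH[folded e_def] by (simp add: H algebra_simps)
    finally show ?thesis .
  qed
  ultimately show ?thesis
    using lie \<open>is_basis d B'\<close> by (simp add: realises_def)
qed

text \<open>The Jacobi identity on \<open>D\<close>, \<open>H\<close>, \<open>P_1\<close> gives the
  first equation. The others say that \<open>H\<close> and \<open>D\<close> multiply the bracket of
  \<open>P_1\<close> and \<open>P_2\<close> by \<open>2 * h\<close> and
  \<open>2 * g\<close>.\<close>

lemma normalised_jacobi: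
  assumes norm: "normalised d br B s b c h g v w"
  shows "v * h + w * g = 0" "h * s = 0" "- (c * v) = 2 * h * b" "- (c * w) = 2 * h * c"
    "g * s = 0" "b * v = 2 * g * b" "b * w = 2 * g * c"
proof -
  note mem = one_two_mem
  have nPP: "br (Pv B 1) (Pv B 2) = s *\<^sub>R Jv B 1 2 + b *\<^sub>R Hv B + c *\<^sub>R Dv B"
    using norm mem by (simp add: normalised_def eps2_def del: One_nat_def atLeastAtMost_iff)
  have nHP: "br (Hv B) (Pv B a) = h *\<^sub>R Pv B a" "br (Dv B) (Pv B a) = g *\<^sub>R Pv B a"
    if "a \<in> {1..d}" for a
    using norm that by (simp_all add: normalised_def)
  have nDH: "br (Dv B) (Hv B) = v *\<^sub>R Hv B + w *\<^sub>R Dv B"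
    using norm by (simp add: normalised_def)
  have nHD: "br (Hv B) (Dv B) = - (v *\<^sub>R Hv B + w *\<^sub>R Dv B)"
    using br_commute[of "Hv B" "Dv B"] nDH by simp
  have "cP 1 (br (Dv B) (br (Hv B) (Pv B 1))) = cP 1 (br (br (Dv B) (Hv B)) (Pv B 1) + br (Hv B) (br (Dv B) (Pv B 1)))"
    by (subst br_derivation) simp
  then show "v * h + w * g = 0"
    using mem by (simp add: nHP nDH del: One_nat_def atLeastAtMost_iff)
  have eqH: "br (Hv B) (br (Pv B 1) (Pv B 2)) = (2 * h) *\<^sub>R br (Pv B 1) (Pv B 2)"
    and eqD: "br (Dv B) (br (Pv B 1) (Pv B 2)) = (2 * g) *\<^sub>R br (Pv B 1) (Pv B 2)"
    using mem br_derivation[of "Hv B" "Pv B 1" "Pv B 2"] br_derivation[of "Dv B" "Pv B 1" "Pv B 2"]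
    by (simp_all add: nHP scaleR_2 del: One_nat_def atLeastAtMost_iff flip: scaleR_scaleR)
  have H: "c *\<^sub>R - (v *\<^sub>R Hv B + w *\<^sub>R Dv B) = (2 * h) *\<^sub>R (s *\<^sub>R Jv B 1 2 + b *\<^sub>R Hv B + c *\<^sub>R Dv B)"
    using eqH mem unfolding nPP by (simp add: br_HJ nHD del: One_nat_def atLeastAtMost_iff)
  have D: "b *\<^sub>R (v *\<^sub>R Hv B + w *\<^sub>R Dv B) = (2 * g) *\<^sub>R (s *\<^sub>R Jv B 1 2 + b *\<^sub>R Hv B + c *\<^sub>R Dv B)"
    using eqD mem unfolding nPP by (simp add: br_DJ nDH del: One_nat_def atLeastAtMost_iff)
  show "h * s = 0" "- (c * v) = 2 * h * b" "- (c * w) = 2 * h * c"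
    using arg_cong[OF H, of "cJ 1 2"] arg_cong[OF H, of cH] arg_cong[OF H, of cD] mem
    by (simp_all del: One_nat_def atLeastAtMost_iff)
  show "g * s = 0" "b * v = 2 * g * b" "b * w = 2 * g * c"
    using arg_cong[OF D, of "cJ 1 2"] arg_cong[OF D, of cH] arg_cong[OF D, of cD] mem
    by (simp_all del: One_nat_def atLeastAtMost_iff)
qed

lemma normalised_realises:
  assumes norm: "normalised d br B s b c h g v w"
  shows "\<exists>L B'. valid_lab d L \<and> realises d L br B'"
proof -
  note jac = normalised_jacobi[OF norm]
  note I = realises_change_basis[OF norm]
  have bc: "d \<noteq> 2 \<Longrightarrow> b = 0 \<and> c = 0" using norm by (simp add: normalised_def)
  have pos: "x\<^sup>2 + y\<^sup>2 \<noteq> 0" if "x \<noteq> 0 \<or> y \<noteq> 0" for x y :: real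
    using that by (simp add: sum_power2_eq_zero_iff)
  have unit: "x * (x / (x\<^sup>2 + y\<^sup>2)) + y * (y / (x\<^sup>2 + y\<^sup>2)) = 1" if "x \<noteq> 0 \<or> y \<noteq> 0" for x y :: real
    using pos[OF that] by (simp add: power2_eq_square flip: add_divide_distrib)
  show ?thesis
  proof (cases "s = 0")
    case False
    then have hg: "h = 0" "g = 0" using jac by auto
    define \<sigma> where "\<sigma> = (0 < s)"
    have r: "(1 / sqrt \<bar>s\<bar>)\<^sup>2 = sgn_of \<sigma> / s"
      using False by (auto simp: power_divide sgn_of_eq \<sigma>_def)
    show ?thesis
    proof (cases "v = 0 \<and> w = 0")
      case True
      \<comment> \<open>The shift of \<open>J_12\<close> absorbs \<open>b\<close> and
        \<open>c\<close>; the scaling of \<open>P\<close> brings \<open>s\<close> to its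
        sign.\<close>
      have "realises d (A4 \<sigma>) br (change_basis B ((b / s) *\<^sub>R Hv B + (c / s) *\<^sub>R Dv B) (1 / sqrt \<bar>s\<bar>)
          (1 *\<^sub>R Hv B + 0 *\<^sub>R Dv B) (0 *\<^sub>R Hv B + 1 *\<^sub>R Dv B))"
        by (rule I, unfold r) (use False hg True bc in auto)
      then show ?thesis using d_ge_2 by (intro exI[of _ "A4 \<sigma>"]) auto
    next
      case nz: False
      have bc0: "b = 0" "c = 0" using jac nz hg by auto
      \<comment> \<open>The new \<open>H\<close> is the old bracket of \<open>D\<close> with
        \<open>H\<close>; the new \<open>D\<close> is orthogonal to it in coordinates and scaled to
        determinant 1.\<close>
      have "realises d (A5 \<sigma>) br (change_basis B (0 *\<^sub>R Hv B + 0 *\<^sub>R Dv B) (1 / sqrt \<bar>s\<bar>)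
          (v *\<^sub>R Hv B + w *\<^sub>R Dv B) ((- w / (v\<^sup>2 + w\<^sup>2)) *\<^sub>R Hv B + (v / (v\<^sup>2 + w\<^sup>2)) *\<^sub>R Dv B))"
        by (rule I, unfold r) (use False hg nz bc0 unit[of v w] in auto)
      then show ?thesis using d_ge_2 by (intro exI[of _ "A5 \<sigma>"]) auto
    qed
  next
    case s0: True
    show ?thesis
    proof (cases "b = 0 \<and> c = 0")
      case bc0: True
      show ?thesis
      proof (cases "h = 0 \<and> g = 0")
        case hg: True
        show ?thesis
        proof (cases "v = 0 \<and> w = 0")
          case True
          have "realises d A1 br (change_basis B (0 *\<^sub>R Hv B + 0 *\<^sub>R Dv B) 1
              (1 *\<^sub>R Hv B + 0 *\<^sub>R Dv B) (0 *\<^sub>R Hv B + 1 *\<^sub>R Dv B))"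
            by (rule I) (use s0 hg True bc0 in auto)
          then show ?thesis using d_ge_2 by (intro exI[of _ A1]) auto
        next
          case False
          have "realises d A2 br (change_basis B (0 *\<^sub>R Hv B + 0 *\<^sub>R Dv B) 1
              (v *\<^sub>R Hv B + w *\<^sub>R Dv B) ((- w / (v\<^sup>2 + w\<^sup>2)) *\<^sub>R Hv B + (v / (v\<^sup>2 + w\<^sup>2)) *\<^sub>R Dv B))"
            by (rule I) (use s0 hg False bc0 unit[of v w] in auto)
          then show ?thesis using d_ge_2 by (intro exI[of _ A2]) auto
        qed
      next
        case hg: False
        define N where "N = g\<^sup>2 + h\<^sup>2"
        define z where "z = (v * g - w * h) / N"
        have N: "N \<noteq> 0" using hg pos[of g h] by (auto simp: N_def)
        \<comment> \<open>The Jacobi identity makes \<open>(v, w)\<close> orthogonal to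
          \<open>(h, g)\<close>, hence \<open>z\<close> times \<open>(g, -h)\<close>. The vector
          with these last coordinates commutes with \<open>P\<close> and becomes the new
          \<open>H\<close>.\<close>
        have "v * N = (v * g - w * h) * g + h * (v * h + w * g)"
          "w * N = (v * g - w * h) * - h + g * (v * h + w * g)"
          by (simp_all add: N_def power2_eq_square algebra_simps)
        then have "v * N = (v * g - w * h) * g" "w * N = (v * g - w * h) * - h"
          unfolding jac(1) by simp_all
        then have z: "v = z * g" "w = z * - h"
          unfolding z_def times_divide_eq_left nonzero_eq_divide_eq[OF N] by simp_all
        have det: "g * (g / N) - - h * (h / N) = 1"
          using unit[of g h] hg by (auto simp: N_def)
        have "realises d (A3 z) br (change_basis B (0 *\<^sub>R Hv B + 0 *\<^sub>R Dv B) 1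
            (g *\<^sub>R Hv B + (- h) *\<^sub>R Dv B) ((h / N) *\<^sub>R Hv B + (g / N) *\<^sub>R Dv B))"
          by (rule I, unfold det) (use s0 bc0 z det in \<open>auto simp: algebra_simps\<close>)
        then show ?thesis using d_ge_2 by (intro exI[of _ "A3 z"]) auto
      qed
    next
      case bc0: False
      then have "d = 2" using bc by blast
      define N where "N = b\<^sup>2 + c\<^sup>2"
      define k where "k = (g * b - h * c) / N"
      have N: "N \<noteq> 0" using bc0 pos[of b c] by (auto simp: N_def)
      \<comment> \<open>So \<open>b *\<^sub>R Hv B + c *\<^sub>R Dv B\<close>, the bracket of
        \<open>P_1\<close> and \<open>P_2\<close>, commutes with \<open>P\<close> and can serve as
        the new \<open>H\<close>.\<close>
      have orth: "b * h + c * g = 0"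
      proof (cases "b = 0")
        case True
        then show ?thesis using jac bc0 by auto
      next
        case False
        then show ?thesis using jac by (auto simp: algebra_simps)
      qed
      have "g * N = (g * b - h * c) * b + c * (b * h + c * g)"
        "h * N = (g * b - h * c) * - c + b * (b * h + c * g)"
        by (simp_all add: N_def power2_eq_square algebra_simps)
      then have "g * N = (g * b - h * c) * b" "h * N = (g * b - h * c) * - c"
        unfolding orth by simp_all
      then have "g = k * b" "h = k * - c"
        unfolding k_def times_divide_eq_left nonzero_eq_divide_eq[OF N] by simp_all
      then have gh: "g = k * b" "h = - k * c" by simp_all
      have vw: "v = 2 * k * b" "w = 2 * k * c"
        using jac(3,4,6,7) bc0 unfolding gh by (cases "b = 0"; force simp: algebra_simps)+
      have det: "b * (b / N) - c * (- c / N) = 1"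
        using unit[of b c] bc0 by (auto simp: N_def)
      show ?thesis
      proof (cases "k = 0")
        case True
        have "realises d A6 br (change_basis B (0 *\<^sub>R Hv B + 0 *\<^sub>R Dv B) 1
            (b *\<^sub>R Hv B + c *\<^sub>R Dv B) ((- c / N) *\<^sub>R Hv B + (b / N) *\<^sub>R Dv B))"
          by (rule I, unfold det) (use True s0 gh vw in auto)
        then show ?thesis using \<open>d = 2\<close> by (intro exI[of _ A6]) auto
      next
        case False
        \<comment> \<open>Dividing the new \<open>D\<close> by \<open>k\<close> gives
          \<open>P\<close> weight 1; then \<open>(v, w) = 2 * k * (b, c)\<close> yields weight 2 on
          \<open>H\<close>.\<close>
        have det': "b * (b / N / k) - c * (- c / N / k) = 1 / k"
          using arg_cong[OF det, of "\<lambda>t. t / k"] by (simp add: diff_divide_distrib add_divide_distrib)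
        have DP: "- c / N / k * h + b / N / k * g = 1"
          using det False unfolding gh by (simp add: algebra_simps)
        have "realises d A7 br (change_basis B (0 *\<^sub>R Hv B + 0 *\<^sub>R Dv B) 1
            (b *\<^sub>R Hv B + c *\<^sub>R Dv B) ((- c / N / k) *\<^sub>R Hv B + (b / N / k) *\<^sub>R Dv B))"
          by (rule I, unfold det' DP) (use False s0 gh vw in auto)
        then show ?thesis using \<open>d = 2\<close> by (intro exI[of _ A7]) auto
      qed
    qed
  qed
qed

end

lemma lifshitz_realises:
  fixes br :: "'v::real_vector \<Rightarrow> 'v \<Rightarrow> 'v"
  assumes "2 \<le> d" "lifshitz d br B"
  shows "\<exists>L B'. valid_lab d L \<and> realises d L br B'"
proof -
  interpret lifshitz_algebra d B br
    using assms by unfold_locales (auto simp: lifshitz_def)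
  show ?thesis
    using normalise lifshitz_algebra.normalised_realises by metis
qed

theorem theorem3p2:
  fixes d :: nat and br :: "'v::real_vector \<Rightarrow> 'v \<Rightarrow> 'v" and B :: "lidx \<Rightarrow> 'v"
  assumes "2 \<le> d" and "lifshitz d br B"
  shows "\<exists>!L. valid_lab d L \<and>
           (\<exists>(br' :: 'v \<Rightarrow> 'v \<Rightarrow> 'v) B' f. realises d L br' B' \<and> lie_iso br br' f)"
proof -
  have lie: "lie_algebra br" using assms(2) by (simp add: lifshitz_def)
  obtain L B' where L: "valid_lab d L" "realises d L br B'"
    using lifshitz_realises[OF assms] by blast
  have "lie_iso br br id" by (simp add: lie_iso_def linear_id)
  show ?thesis
  proof (rule ex1I[of _ L])
    show "valid_lab d L \<and> (\<exists>(br' :: 'v \<Rightarrow> 'v \<Rightarrow> 'v) B' f. realises d L br' B' \<and> lie_iso br br' f)"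
      using L \<open>lie_iso br br id\<close> by blast
    \<comment> \<open>An isomorphism witnessing \<open>M\<close> is pulled back to a basis for
      \<open>br\<close> itself, where both labels can be compared.\<close>
    show "M = L" if "valid_lab d M \<and> (\<exists>(br' :: 'v \<Rightarrow> 'v \<Rightarrow> 'v) B' f. realises d M br' B' \<and> lie_iso br br' f)" for M
      using that L realises_pullback[OF lie] realises_unique[OF assms(1)] by metis
  qed
qed

end
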